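(* Let $M_R$ be an injective right module over a ring $R$ and let $S=\mathrm{End}(M_R)$. If each right singular element $s\in S$ can be expressed as a product of idempotents of $S$, then $S$ has stable range $1$.
   Context: Rings are nonzero, associative, with identity, and need not be commutative. A right $R$-module $M$ is injective if every $R$-homomorphism from a right ideal of $R$ to $M$ extends to an $R$-homomorphism from $R$ to $M$. An element $s\in S$ is right singular if its right annihilator $r.ann(s)=\{t\in S: st=0\}$ is nonzero. A ring $S$ has stable range $1$ if for any $a,b\in S$ with $aS+bS=S$ there exists $x\in S$ such that $a+bx$ is invertible. *)

theory Defs
  imports "HOL-Algebra.AbelCoset"
begin

text \<open>The multiplicative fields that the record inherits from \<^typ>\<open>'b ring\<close> are not used, as
  with \<open>module\<close> in \<open>HOL-Algebra.Module\<close>.\<close>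

record ('a, 'b) right_module = "'b ring" +
  rsmult :: "['b, 'a] \<Rightarrow> 'b" (infixl \<open>\<odot>\<^sub>r\<index>\<close> 70)

locale right_module = R?: ring R + M?: abelian_group M
  for R :: "('a, 'r) ring_scheme" (structure)
    and M :: "('a, 'b, 'm) right_module_scheme" (structure) +
  assumes rsmult_closed [simp, intro]:
      "\<lbrakk>x \<in> carrier M; a \<in> carrier R\<rbrakk> \<Longrightarrow> x \<odot>\<^sub>r\<^bsub>M\<^esub> a \<in> carrier M"
    and rsmult_l_distr:
      "\<lbrakk>x \<in> carrier M; y \<in> carrier M; a \<in> carrier R\<rbrakk>
        \<Longrightarrow> (x \<oplus>\<^bsub>M\<^esub> y) \<odot>\<^sub>r\<^bsub>M\<^esub> a = x \<odot>\<^sub>r\<^bsub>M\<^esub> a \<oplus>\<^bsub>M\<^esub> y \<odot>\<^sub>r\<^bsub>M\<^esub> a"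
    and rsmult_r_distr:
      "\<lbrakk>x \<in> carrier M; a \<in> carrier R; b \<in> carrier R\<rbrakk>
        \<Longrightarrow> x \<odot>\<^sub>r\<^bsub>M\<^esub> (a \<oplus>\<^bsub>R\<^esub> b) = x \<odot>\<^sub>r\<^bsub>M\<^esub> a \<oplus>\<^bsub>M\<^esub> x \<odot>\<^sub>r\<^bsub>M\<^esub> b"
    and rsmult_assoc:
      "\<lbrakk>x \<in> carrier M; a \<in> carrier R; b \<in> carrier R\<rbrakk>
        \<Longrightarrow> x \<odot>\<^sub>r\<^bsub>M\<^esub> (a \<otimes>\<^bsub>R\<^esub> b) = (x \<odot>\<^sub>r\<^bsub>M\<^esub> a) \<odot>\<^sub>r\<^bsub>M\<^esub> b"
    and rsmult_one [simp]:
      "x \<in> carrier M \<Longrightarrow> x \<odot>\<^sub>r\<^bsub>M\<^esub> \<one>\<^bsub>R\<^esub> = x"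

definition right_hom ::
  "('a, 'r) ring_scheme \<Rightarrow> ('a, 'b, 'm) right_module_scheme \<Rightarrow> ('a, 'c, 'n) right_module_scheme
    \<Rightarrow> ('b \<Rightarrow> 'c) set"
  where "right_hom R M N =
    {f \<in> carrier M \<rightarrow> carrier N.
      (\<forall>x \<in> carrier M. \<forall>y \<in> carrier M. f (x \<oplus>\<^bsub>M\<^esub> y) = f x \<oplus>\<^bsub>N\<^esub> f y) \<and>
      (\<forall>x \<in> carrier M. \<forall>a \<in> carrier R. f (x \<odot>\<^sub>r\<^bsub>M\<^esub> a) = f x \<odot>\<^sub>r\<^bsub>N\<^esub> a)}"

definition right_ideal :: "'a set \<Rightarrow> ('a, 'r) ring_scheme \<Rightarrow> bool"
  where "right_ideal I R \<longleftrightarrow>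
    additive_subgroup I R \<and> (\<forall>x \<in> I. \<forall>a \<in> carrier R. x \<otimes>\<^bsub>R\<^esub> a \<in> I)"

definition ideal_module :: "('a, 'r) ring_scheme \<Rightarrow> 'a set \<Rightarrow> ('a, 'a) right_module"
  where "ideal_module R I =
    \<lparr>carrier = I, mult = mult R, one = \<one>\<^bsub>R\<^esub>, zero = \<zero>\<^bsub>R\<^esub>, add = add R,
      rsmult = mult R\<rparr>"

definition injective_module ::
  "('a, 'r) ring_scheme \<Rightarrow> ('a, 'b, 'm) right_module_scheme \<Rightarrow> bool"
  where "injective_module R M \<longleftrightarrow>
    (\<forall>I f. right_ideal I R \<longrightarrow> f \<in> right_hom R (ideal_module R I) M \<longrightarrow>
      (\<exists>g \<in> right_hom R (ideal_module R (carrier R)) M. \<forall>x \<in> I. g x = f x))"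

text \<open>Endomorphisms are normalised to \<^const>\<open>undefined\<close> outside the carrier, so that equality of
  functions is equality of endomorphisms.  They act on the left of the right module, so
  the product is \<open>(f g) x = f (g x)\<close>.\<close>

definition End_ring ::
  "('a, 'r) ring_scheme \<Rightarrow> ('a, 'b, 'm) right_module_scheme \<Rightarrow> ('b \<Rightarrow> 'b) ring"
  where "End_ring R M =
    \<lparr>carrier = right_hom R M M \<inter> extensional (carrier M),
     mult = compose (carrier M),
     one = (\<lambda>x \<in> carrier M. x),
     zero = (\<lambda>x \<in> carrier M. \<zero>\<^bsub>M\<^esub>),
     add = (\<lambda>f g. \<lambda>x \<in> carrier M. f x \<oplus>\<^bsub>M\<^esub> g x)\<rparr>"

definition right_annihilator :: "('a, 's) ring_scheme \<Rightarrow> 'a \<Rightarrow> 'a set"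
  where "right_annihilator S s = {t \<in> carrier S. s \<otimes>\<^bsub>S\<^esub> t = \<zero>\<^bsub>S\<^esub>}"

definition right_singular :: "('a, 's) ring_scheme \<Rightarrow> 'a \<Rightarrow> bool"
  where "right_singular S s \<longleftrightarrow> s \<in> carrier S \<and> right_annihilator S s \<noteq> {\<zero>\<^bsub>S\<^esub>}"

definition idempotents :: "('a, 's) ring_scheme \<Rightarrow> 'a set"
  where "idempotents S = {e \<in> carrier S. e \<otimes>\<^bsub>S\<^esub> e = e}"

definition product_of_idempotents :: "('a, 's) ring_scheme \<Rightarrow> 'a \<Rightarrow> bool"
  where "product_of_idempotents S s \<longleftrightarrow>
    (\<exists>es. es \<noteq> [] \<and> set es \<subseteq> idempotents S \<and> s = foldr (mult S) es \<one>\<^bsub>S\<^esub>)"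

definition stable_range_one :: "('a, 's) ring_scheme \<Rightarrow> bool"
  where "stable_range_one S \<longleftrightarrow>
    (\<forall>a \<in> carrier S. \<forall>b \<in> carrier S.
      (a <#\<^bsub>S\<^esub> carrier S) <+>\<^bsub>S\<^esub> (b <#\<^bsub>S\<^esub> carrier S) = carrier S \<longrightarrow>
      (\<exists>x \<in> carrier S. a \<oplus>\<^bsub>S\<^esub> b \<otimes>\<^bsub>S\<^esub> x \<in> Units S))"

lemma (in ring) right_module_ideal_module:
  assumes "right_ideal I R"
  shows "right_module R (ideal_module R I)"
proof -
  interpret I: additive_subgroup I R
    using assms by (simp add: right_ideal_def)
  have sub: "x \<in> carrier R" if "x \<in> I" for x
    using that by (rule I.a_Hcarr)
  have neg: "\<exists>y\<in>I. y \<oplus> x = \<zero>" if "x \<in> I" for x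
    using that sub by (intro bexI[of _ "\<ominus> x"]) (auto simp: l_neg I.a_inv_closed)
  have mult: "x \<otimes> a \<in> I" if "x \<in> I" "a \<in> carrier R" for x a
    using assms that by (auto simp: right_ideal_def)
  have "abelian_group (ideal_module R I)"
    by (rule abelian_groupI, unfold ideal_module_def ring.simps monoid.simps partial_object.simps)
      (simp_all add: sub a_assoc neg, simp add: sub a_comm)
  then show ?thesis
    by (intro right_module.intro right_module_axioms.intro ring_axioms)
      (simp_all add: ideal_module_def sub mult l_distr r_distr m_assoc)
qed

lemma (in right_module) ring_End_ring: "ring (End_ring R M)"
proof -
  let ?E = "End_ring R M"
  define H where "H = right_hom R M M \<inter> extensional (carrier M)"
  have z: "\<zero>\<^bsub>M\<^esub> \<odot>\<^sub>r\<^bsub>M\<^esub> a = \<zero>\<^bsub>M\<^esub>" if "a \<in> carrier R" for a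
  proof -
    have "\<zero>\<^bsub>M\<^esub> \<odot>\<^sub>r\<^bsub>M\<^esub> a \<oplus>\<^bsub>M\<^esub> \<zero>\<^bsub>M\<^esub> \<odot>\<^sub>r\<^bsub>M\<^esub> a = \<zero>\<^bsub>M\<^esub> \<odot>\<^sub>r\<^bsub>M\<^esub> a"
      using that by (simp flip: rsmult_l_distr)
    then show ?thesis
      using that by (simp add: M.add.r_cancel_one)
  qed
  have n: "(\<ominus>\<^bsub>M\<^esub> x) \<odot>\<^sub>r\<^bsub>M\<^esub> a = \<ominus>\<^bsub>M\<^esub> (x \<odot>\<^sub>r\<^bsub>M\<^esub> a)" if "x \<in> carrier M" "a \<in> carrier R" for x a
    using rsmult_l_distr[of "\<ominus>\<^bsub>M\<^esub> x" x a] that z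
    by (intro M.minus_equality[symmetric]) (auto simp: M.l_neg)
  have cl: "f x \<in> carrier M" if "f \<in> H" "x \<in> carrier M" for f x
    using that by (auto simp: H_def right_hom_def)
  have ad: "f (x \<oplus>\<^bsub>M\<^esub> y) = f x \<oplus>\<^bsub>M\<^esub> f y" if "f \<in> H" "x \<in> carrier M" "y \<in> carrier M" for f x y
    using that by (auto simp: H_def right_hom_def)
  have sm: "f (x \<odot>\<^sub>r\<^bsub>M\<^esub> a) = f x \<odot>\<^sub>r\<^bsub>M\<^esub> a" if "f \<in> H" "x \<in> carrier M" "a \<in> carrier R" for f x a
    using that by (auto simp: H_def right_hom_def)
  have HI: "(\<lambda>x\<in>carrier M. f x) \<in> H"
    if "\<And>x. x \<in> carrier M \<Longrightarrow> f x \<in> carrier M"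
      "\<And>x y. x \<in> carrier M \<Longrightarrow> y \<in> carrier M \<Longrightarrow> f (x \<oplus>\<^bsub>M\<^esub> y) = f x \<oplus>\<^bsub>M\<^esub> f y"
      "\<And>x a. x \<in> carrier M \<Longrightarrow> a \<in> carrier R \<Longrightarrow> f (x \<odot>\<^sub>r\<^bsub>M\<^esub> a) = f x \<odot>\<^sub>r\<^bsub>M\<^esub> a" for f
    using that by (auto simp: H_def right_hom_def)
  have plus: "(\<lambda>x\<in>carrier M. f x \<oplus>\<^bsub>M\<^esub> g x) \<in> H" if "f \<in> H" "g \<in> H" for f g
    using cl[OF that(1)] cl[OF that(2)]
    by (intro HI) (simp_all add: ad that sm rsmult_l_distr M.a_ac)
  have comp: "compose (carrier M) f g \<in> H" if "f \<in> H" "g \<in> H" for f g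
    unfolding compose_def using cl[OF that(1)] cl[OF that(2)]
    by (intro HI) (simp_all add: ad that sm)
  have zero: "(\<lambda>x\<in>carrier M. \<zero>\<^bsub>M\<^esub>) \<in> H"
    by (intro HI) (simp_all add: z)
  have one: "(\<lambda>x\<in>carrier M. x) \<in> H"
    by (intro HI) simp_all
  have neg: "(\<lambda>x\<in>carrier M. \<ominus>\<^bsub>M\<^esub> f x) \<in> H" if "f \<in> H" for f
    using cl[OF that] by (intro HI) (simp_all add: ad that sm n M.minus_add M.a_comm)
  have ext: "f = g" if "f \<in> H" "g \<in> H" "\<And>x. x \<in> carrier M \<Longrightarrow> f x = g x" for f g
    using that by (intro extensionalityI[of f "carrier M" g]) (auto simp: H_def)
  have cE: "carrier ?E = H"
    by (simp add: End_ring_def H_def)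
  have plusE: "f \<oplus>\<^bsub>?E\<^esub> g = (\<lambda>x\<in>carrier M. f x \<oplus>\<^bsub>M\<^esub> g x)" for f g
    by (simp add: End_ring_def)
  have compE: "f \<otimes>\<^bsub>?E\<^esub> g = compose (carrier M) f g" for f g
    by (simp add: End_ring_def)
  have zeroE: "\<zero>\<^bsub>?E\<^esub> = (\<lambda>x\<in>carrier M. \<zero>\<^bsub>M\<^esub>)"
    by (simp add: End_ring_def)
  have oneE: "\<one>\<^bsub>?E\<^esub> = (\<lambda>x\<in>carrier M. x)"
    by (simp add: End_ring_def)
  note E = cE plusE compE zeroE oneE
  show ?thesis
  proof (rule ringI)
    show "abelian_group ?E"
    proof (rule abelian_groupI, unfold E)
      fix f assume f: "f \<in> H"
      show "\<exists>g\<in>H. (\<lambda>x\<in>carrier M. g x \<oplus>\<^bsub>M\<^esub> f x) = (\<lambda>x\<in>carrier M. \<zero>\<^bsub>M\<^esub>)"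
        using cl[OF f] by (intro bexI[OF _ neg[OF f]] restrict_ext) (simp add: M.l_neg)
      show "(\<lambda>x\<in>carrier M. (\<lambda>x\<in>carrier M. \<zero>\<^bsub>M\<^esub>) x \<oplus>\<^bsub>M\<^esub> f x) = f"
        using cl[OF f] by (intro ext plus zero f) simp
    next
      fix f g h assume fgh: "f \<in> H" "g \<in> H" "h \<in> H"
      show "(\<lambda>x\<in>carrier M. (\<lambda>x\<in>carrier M. f x \<oplus>\<^bsub>M\<^esub> g x) x \<oplus>\<^bsub>M\<^esub> h x) =
            (\<lambda>x\<in>carrier M. f x \<oplus>\<^bsub>M\<^esub> (\<lambda>x\<in>carrier M. g x \<oplus>\<^bsub>M\<^esub> h x) x)"
        using cl[OF fgh(1)] cl[OF fgh(2)] cl[OF fgh(3)]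
        by (intro restrict_ext) (simp add: M.a_assoc)
    next
      fix f g assume fg: "f \<in> H" "g \<in> H"
      show "(\<lambda>x\<in>carrier M. f x \<oplus>\<^bsub>M\<^esub> g x) = (\<lambda>x\<in>carrier M. g x \<oplus>\<^bsub>M\<^esub> f x)"
        using cl[OF fg(1)] cl[OF fg(2)] by (intro restrict_ext) (simp add: M.a_comm)
    qed (fact plus zero)+
    show "monoid ?E"
    proof (rule monoidI, unfold E)
      fix f g h assume fgh: "f \<in> H" "g \<in> H" "h \<in> H"
      show "compose (carrier M) (compose (carrier M) f g) h =
            compose (carrier M) f (compose (carrier M) g h)"
        using cl[OF fgh(3)] by (intro ext comp fgh) (simp add: compose_def)
    next
      fix f assume f: "f \<in> H"
      show "compose (carrier M) (\<lambda>x\<in>carrier M. x) f = f"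
        using cl[OF f] by (intro ext comp one f) (simp add: compose_def)
      show "compose (carrier M) f (\<lambda>x\<in>carrier M. x) = f"
        by (intro ext comp one f) (simp add: compose_def)
    qed (fact comp one)+
  next
    fix f g h assume "f \<in> carrier ?E" "g \<in> carrier ?E" "h \<in> carrier ?E"
    then have fgh: "f \<in> H" "g \<in> H" "h \<in> H"
      by (simp_all only: cE)
    show "(f \<oplus>\<^bsub>?E\<^esub> g) \<otimes>\<^bsub>?E\<^esub> h = f \<otimes>\<^bsub>?E\<^esub> h \<oplus>\<^bsub>?E\<^esub> g \<otimes>\<^bsub>?E\<^esub> h"
      unfolding E using cl[OF fgh(3)] by (intro ext comp plus fgh) (simp add: compose_def)
    show "h \<otimes>\<^bsub>?E\<^esub> (f \<oplus>\<^bsub>?E\<^esub> g) = h \<otimes>\<^bsub>?E\<^esub> f \<oplus>\<^bsub>?E\<^esub> h \<otimes>\<^bsub>?E\<^esub> g"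
      unfolding E using cl[OF fgh(1)] cl[OF fgh(2)]
      by (intro ext comp plus fgh) (simp add: compose_def ad fgh)
  qed
qed

end

theory Submission
  imports Defs
begin

text \<open>
  The hypothesis on right singular elements makes \<open>S = End M\<close> directly finite. If \<open>x y = 1\<close> but
  \<open>y x \<noteq> 1\<close>, then \<open>x\<close> kills \<open>1 - y x\<close> on the right, so it is a product of idempotents; but a
  right invertible idempotent is \<open>1\<close>, so all the factors are \<open>1\<close> and \<open>x = y = 1\<close>. As \<open>M\<close> is
  injective, an injective endomorphism has a left inverse, hence is invertible
  (\<open>injective_endo_left_invertible\<close>). So \<open>M\<close> is co-Hopfian, and the aim, given
  \<open>a a' + b b' = 1\<close>, is to choose \<open>x\<close> such that \<open>u = a + b x\<close> is injective
  (\<open>co_hopfian_substitution\<close>).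

  Choose a submodule \<open>D\<close> and \<open>x\<close> on \<open>D\<close> such that \<open>a + b x\<close> is injective on \<open>D\<close>, with
  \<open>(D, x)\<close> maximal, and extend \<open>x\<close> to \<open>M\<close> by injectivity. Let \<open>C\<close> be a maximal complement of
  \<open>u D\<close>. Maximality says two things. First, \<open>D + ker u\<close> is essential, since otherwise \<open>D\<close> could be
  enlarged without changing \<open>x\<close>. Second, no nonzero submodule of \<open>ker u\<close> is isomorphic to a
  submodule of \<open>C\<close>: from such an isomorphism \<open>\<phi>\<close>, adding \<open>(b' - x a') \<phi>\<close> to \<open>x\<close> gives \<open>a + b x\<close>
  the value \<open>\<phi> - u a' \<phi>\<close> on \<open>ker u\<close>, and this agrees with \<open>\<phi>\<close> modulo \<open>u D\<close> wherever
  \<open>a' \<phi>\<close> lies in the essential submodule \<open>D + ker u\<close>.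

  The inverse of \<open>u\<close> on \<open>u D\<close>, together with zero on \<open>C\<close>, extends to an endomorphism \<open>t\<close> with
  kernel \<open>C\<close> whose image meets \<open>ker u\<close> trivially. It remains to see that over a co-Hopfian \<open>M\<close> a
  submodule \<open>E\<close> that meets the image of \<open>t\<close> trivially and shares no nonzero isomorphic submodule
  with \<open>ker t\<close> must vanish (\<open>co_hopfian_cokernel_trivial\<close>). Let \<open>K\<close> be the union of the kernels of
  the powers of \<open>t\<close> and \<open>H\<close> a maximal complement of \<open>K\<close>. The map that is \<open>t\<close> on \<open>H\<close> and the
  identity on \<open>K\<close> is injective on an essential submodule, so it extends to an automorphism of \<open>M\<close>,
  and \<open>t H + K\<close> is essential. An element of \<open>E\<close> of the form \<open>t h + k\<close> determines \<open>k\<close> and is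
  determined by it, so \<open>E \<inter> (t H + K)\<close> embeds in \<open>K\<close>. Finally \<open>K\<close> is filtered by the kernels of
  the powers of \<open>t\<close>, and each layer of the filtration embeds in \<open>ker t\<close>, so \<open>E\<close> has no nonzero
  submodule isomorphic to one of \<open>K\<close>.

  Homomorphisms defined on submodules are treated throughout as their graphs, which are submodules
  of \<open>M \<times> M\<close>; a single maximality lemma, \<open>right_submodule_maximal\<close>, then serves for extending
  maps, for complements and for the choice of \<open>(D, x)\<close>.
\<close>

section \<open>Right singular elements and direct finiteness\<close>

lemma (in abelian_group) diff_eq_zero_iff:
  assumes "x \<in> carrier G" "y \<in> carrier G"
  shows "x \<ominus> y = \<zero> \<longleftrightarrow> x = y"
  using assms minus_equality[of x "\<ominus> y"] by (auto simp: minus_eq r_neg)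

text \<open>If \<open>e z = 1\<close> with \<open>e\<close> idempotent, then \<open>e = e (e z) = e z = 1\<close>; so the factors are \<open>1\<close>, one after
  the other from the left.\<close>

lemma (in ring) product_of_idempotents_right_invertible:
  assumes "product_of_idempotents R s" and "y \<in> carrier R" and "s \<otimes> y = \<one>"
  shows "s = \<one>"
proof -
  have clo: "foldr (\<otimes>) es \<one> \<in> carrier R" if "set es \<subseteq> idempotents R" for es
    using that by (induction es) (auto simp: idempotents_def)
  have "foldr (\<otimes>) es \<one> = \<one>" if "set es \<subseteq> idempotents R" "foldr (\<otimes>) es \<one> \<otimes> y = \<one>" for es
    using that
  proof (induction es)
    case (Cons e es)
    have e: "e \<in> carrier R" "e \<otimes> e = e" and es: "set es \<subseteq> idempotents R"
      using Cons.prems by (auto simp: idempotents_def)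
    define z where "z = foldr (\<otimes>) es \<one> \<otimes> y"
    have z: "z \<in> carrier R" "e \<otimes> z = \<one>"
      using Cons.prems(2) e clo[OF es] assms(2) by (auto simp: z_def m_assoc)
    have "e = e \<otimes> (e \<otimes> z)"
      using e z by simp
    also have "\<dots> = \<one>"
      using e z m_assoc[of e e z] by metis
    finally have "e = \<one>" .
    then show ?case
      using Cons es clo[OF es] by auto
  qed simp
  then show ?thesis
    using assms by (auto simp: product_of_idempotents_def)
qed

lemma (in ring) directly_finite_if_right_singular_products:
  assumes "\<And>s. \<lbrakk>s \<in> carrier R; right_singular R s\<rbrakk> \<Longrightarrow> product_of_idempotents R s"
    and x: "x \<in> carrier R" and y: "y \<in> carrier R" and xy: "x \<otimes> y = \<one>"
  shows "y \<otimes> x = \<one>"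
proof (rule ccontr)
  assume ne: "y \<otimes> x \<noteq> \<one>"
  let ?d = "\<one> \<ominus> y \<otimes> x"
  have d: "?d \<in> carrier R" "?d \<noteq> \<zero>"
    using x y ne diff_eq_zero_iff[of \<one> "y \<otimes> x"] by auto
  have "x \<otimes> ?d = x \<ominus> (x \<otimes> y) \<otimes> x"
    using x y by (simp add: minus_eq r_distr r_minus m_assoc)
  also have "\<dots> = \<zero>"
    using x xy by (simp add: a_minus_def r_neg)
  finally have "?d \<in> right_annihilator R x"
    using d by (simp add: right_annihilator_def)
  then have "right_singular R x"
    using x d by (auto simp: right_singular_def)
  then have "x = \<one>"
    using assms(1) x y xy product_of_idempotents_right_invertible by blast
  with xy y ne show False
    by simp
qed

section \<open>Submodules and linear relations\<close>

definition right_submodule ::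
  "('a, 'r) ring_scheme \<Rightarrow> ('a, 'b, 'm) right_module_scheme \<Rightarrow> 'b set \<Rightarrow> bool"
  where "right_submodule R M A \<longleftrightarrow>
    A \<subseteq> carrier M \<and> \<zero>\<^bsub>M\<^esub> \<in> A \<and> (\<forall>x \<in> A. \<forall>y \<in> A. x \<oplus>\<^bsub>M\<^esub> y \<in> A) \<and>
    (\<forall>x \<in> A. \<forall>a \<in> carrier R. x \<odot>\<^sub>r\<^bsub>M\<^esub> a \<in> A)"

definition prod_module ::
  "('a, 'b, 'm) right_module_scheme \<Rightarrow> ('a, 'c, 'n) right_module_scheme \<Rightarrow> ('a, 'b \<times> 'c) right_module"
  where "prod_module N M =
    \<lparr>carrier = carrier N \<times> carrier M, mult = undefined, one = undefined,
      zero = (\<zero>\<^bsub>N\<^esub>, \<zero>\<^bsub>M\<^esub>),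
      add = (\<lambda>p q. (fst p \<oplus>\<^bsub>N\<^esub> fst q, snd p \<oplus>\<^bsub>M\<^esub> snd q)),
      rsmult = (\<lambda>p a. (fst p \<odot>\<^sub>r\<^bsub>N\<^esub> a, snd p \<odot>\<^sub>r\<^bsub>M\<^esub> a))\<rparr>"

lemma prod_module_simps [simp]:
  "carrier (prod_module N M) = carrier N \<times> carrier M"
  "\<zero>\<^bsub>prod_module N M\<^esub> = (\<zero>\<^bsub>N\<^esub>, \<zero>\<^bsub>M\<^esub>)"
  "(x, y) \<oplus>\<^bsub>prod_module N M\<^esub> (x', y') = (x \<oplus>\<^bsub>N\<^esub> x', y \<oplus>\<^bsub>M\<^esub> y')"
  "(x, y) \<odot>\<^sub>r\<^bsub>prod_module N M\<^esub> a = (x \<odot>\<^sub>r\<^bsub>N\<^esub> a, y \<odot>\<^sub>r\<^bsub>M\<^esub> a)"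
  by (simp_all add: prod_module_def)

lemma right_module_prod_module:
  assumes "right_module R N" and "right_module R M"
  shows "right_module R (prod_module N M)"
proof -
  interpret N: right_module R N by fact
  interpret M: right_module R M by fact
  have "abelian_group (prod_module N M)"
  proof (rule abelian_groupI)
    fix p assume "p \<in> carrier (prod_module N M)"
    then show "\<exists>q \<in> carrier (prod_module N M). q \<oplus>\<^bsub>prod_module N M\<^esub> p = \<zero>\<^bsub>prod_module N M\<^esub>"
      by (intro bexI[of _ "(\<ominus>\<^bsub>N\<^esub> fst p, \<ominus>\<^bsub>M\<^esub> snd p)"]) (auto simp: N.M.l_neg M.M.l_neg)
  qed (auto simp: N.M.a_ac M.M.a_ac)
  then show ?thesis
    by (intro right_module.intro right_module_axioms.intro N.R.ring_axioms)
      (auto simp: N.rsmult_l_distr M.rsmult_l_distr N.rsmult_r_distr M.rsmult_r_distr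
        N.rsmult_assoc M.rsmult_assoc)
qed

lemma right_submodule_prodI:
  assumes "\<And>x y. (x, y) \<in> G \<Longrightarrow> x \<in> carrier N \<and> y \<in> carrier M" and "(\<zero>\<^bsub>N\<^esub>, \<zero>\<^bsub>M\<^esub>) \<in> G"
    and "\<And>x y x' y'. \<lbrakk>(x, y) \<in> G; (x', y') \<in> G\<rbrakk> \<Longrightarrow> (x \<oplus>\<^bsub>N\<^esub> x', y \<oplus>\<^bsub>M\<^esub> y') \<in> G"
    and "\<And>x y a. \<lbrakk>(x, y) \<in> G; a \<in> carrier R\<rbrakk> \<Longrightarrow> (x \<odot>\<^sub>r\<^bsub>N\<^esub> a, y \<odot>\<^sub>r\<^bsub>M\<^esub> a) \<in> G"
  shows "right_submodule R (prod_module N M) G"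
  using assms unfolding right_submodule_def by (auto simp: split_paired_all)

lemma right_submodule_prodD:
  assumes "right_submodule R (prod_module N M) G"
  shows "(x, y) \<in> G \<Longrightarrow> x \<in> carrier N" "(x, y) \<in> G \<Longrightarrow> y \<in> carrier M"
    and "(\<zero>\<^bsub>N\<^esub>, \<zero>\<^bsub>M\<^esub>) \<in> G"
    and "\<lbrakk>(x, y) \<in> G; (x', y') \<in> G\<rbrakk> \<Longrightarrow> (x \<oplus>\<^bsub>N\<^esub> x', y \<oplus>\<^bsub>M\<^esub> y') \<in> G"
    and "\<lbrakk>(x, y) \<in> G; a \<in> carrier R\<rbrakk> \<Longrightarrow> (x \<odot>\<^sub>r\<^bsub>N\<^esub> a, y \<odot>\<^sub>r\<^bsub>M\<^esub> a) \<in> G"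
  using assms unfolding right_submodule_def by fastforce+

lemma right_submoduleD:
  assumes "right_submodule R M A"
  shows "x \<in> A \<Longrightarrow> x \<in> carrier M" "\<zero>\<^bsub>M\<^esub> \<in> A" "\<lbrakk>x \<in> A; y \<in> A\<rbrakk> \<Longrightarrow> x \<oplus>\<^bsub>M\<^esub> y \<in> A"
    "\<lbrakk>x \<in> A; a \<in> carrier R\<rbrakk> \<Longrightarrow> x \<odot>\<^sub>r\<^bsub>M\<^esub> a \<in> A"
  using assms unfolding right_submodule_def by auto

lemma mem_set_add_iff: "z \<in> A <+>\<^bsub>M\<^esub> B \<longleftrightarrow> (\<exists>x \<in> A. \<exists>y \<in> B. z = x \<oplus>\<^bsub>M\<^esub> y)"
  by (auto simp: set_add_def set_mult_def)

context right_module
begin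

lemma zero_rsmult [simp]: "a \<in> carrier R \<Longrightarrow> \<zero>\<^bsub>M\<^esub> \<odot>\<^sub>r\<^bsub>M\<^esub> a = \<zero>\<^bsub>M\<^esub>"
  using rsmult_l_distr[of "\<zero>\<^bsub>M\<^esub>" "\<zero>\<^bsub>M\<^esub>" a] M.add.r_cancel_one by simp

lemma rsmult_zero [simp]: "x \<in> carrier M \<Longrightarrow> x \<odot>\<^sub>r\<^bsub>M\<^esub> \<zero>\<^bsub>R\<^esub> = \<zero>\<^bsub>M\<^esub>"
  using rsmult_r_distr[of x "\<zero>\<^bsub>R\<^esub>" "\<zero>\<^bsub>R\<^esub>"] M.add.r_cancel_one by simp

lemma rsmult_minus_one: "x \<in> carrier M \<Longrightarrow> x \<odot>\<^sub>r\<^bsub>M\<^esub> (\<ominus>\<^bsub>R\<^esub> \<one>\<^bsub>R\<^esub>) = \<ominus>\<^bsub>M\<^esub> x"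
  using rsmult_r_distr[of x "\<ominus>\<^bsub>R\<^esub> \<one>\<^bsub>R\<^esub>" "\<one>\<^bsub>R\<^esub>"]
  by (intro M.minus_equality[symmetric]) (auto simp: R.l_neg)

lemma right_submodule_minus:
  assumes "right_submodule R M A" "x \<in> A"
  shows "\<ominus>\<^bsub>M\<^esub> x \<in> A"
  using assms rsmult_minus_one[of x] right_submoduleD[OF assms(1)]
  by (metis R.add.inv_closed R.one_closed)

lemma subset_right_submodule_set_add:
  assumes "right_submodule R M A" "right_submodule R M B"
  shows "A \<subseteq> A <+>\<^bsub>M\<^esub> B" "B \<subseteq> A <+>\<^bsub>M\<^esub> B"
proof -
  show "A \<subseteq> A <+>\<^bsub>M\<^esub> B"
  proof
    fix x assume "x \<in> A"
    then show "x \<in> A <+>\<^bsub>M\<^esub> B"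
      using right_submoduleD(1)[OF assms(1)] right_submoduleD(2)[OF assms(2)]
      by (force simp: mem_set_add_iff)
  qed
  show "B \<subseteq> A <+>\<^bsub>M\<^esub> B"
  proof
    fix x assume "x \<in> B"
    then show "x \<in> A <+>\<^bsub>M\<^esub> B"
      using right_submoduleD(1)[OF assms(2)] right_submoduleD(2)[OF assms(1)]
      by (force simp: mem_set_add_iff)
  qed
qed

lemma right_submodule_set_add:
  assumes A: "right_submodule R M A" and B: "right_submodule R M B"
  shows "right_submodule R M (A <+>\<^bsub>M\<^esub> B)"
proof -
  note [simp] = right_submoduleD(1)[OF A] right_submoduleD(1)[OF B]
  have add: "z \<oplus>\<^bsub>M\<^esub> w \<in> A <+>\<^bsub>M\<^esub> B" if "z \<in> A <+>\<^bsub>M\<^esub> B" "w \<in> A <+>\<^bsub>M\<^esub> B" for z w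
  proof -
    obtain x y x' y' where xy: "x \<in> A" "y \<in> B" "x' \<in> A" "y' \<in> B"
      and "z = x \<oplus>\<^bsub>M\<^esub> y" "w = x' \<oplus>\<^bsub>M\<^esub> y'"
      using \<open>z \<in> _\<close> \<open>w \<in> _\<close> unfolding mem_set_add_iff by blast
    then have "z \<oplus>\<^bsub>M\<^esub> w = (x \<oplus>\<^bsub>M\<^esub> x') \<oplus>\<^bsub>M\<^esub> (y \<oplus>\<^bsub>M\<^esub> y')"
      by (simp add: M.a_ac)
    then show ?thesis
      using xy right_submoduleD(3)[OF A] right_submoduleD(3)[OF B] unfolding mem_set_add_iff by blast
  qed
  have smult: "z \<odot>\<^sub>r\<^bsub>M\<^esub> a \<in> A <+>\<^bsub>M\<^esub> B" if "z \<in> A <+>\<^bsub>M\<^esub> B" "a \<in> carrier R" for z a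
  proof -
    obtain x y where xy: "x \<in> A" "y \<in> B" and "z = x \<oplus>\<^bsub>M\<^esub> y"
      using \<open>z \<in> _\<close> unfolding mem_set_add_iff by blast
    then have "z \<odot>\<^sub>r\<^bsub>M\<^esub> a = x \<odot>\<^sub>r\<^bsub>M\<^esub> a \<oplus>\<^bsub>M\<^esub> y \<odot>\<^sub>r\<^bsub>M\<^esub> a"
      using that by (simp add: rsmult_l_distr)
    then show ?thesis
      using xy that right_submoduleD(4)[OF A] right_submoduleD(4)[OF B]
      unfolding mem_set_add_iff by blast
  qed
  have "\<zero>\<^bsub>M\<^esub> \<in> A <+>\<^bsub>M\<^esub> B"
    using subset_right_submodule_set_add(1)[OF A B] right_submoduleD(2)[OF A] by blast
  moreover have "A <+>\<^bsub>M\<^esub> B \<subseteq> carrier M"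
    by (auto simp: mem_set_add_iff)
  ultimately show ?thesis
    using add smult unfolding right_submodule_def by blast
qed

lemma right_submodule_cyclic:
  assumes "x \<in> carrier M"
  shows "right_submodule R M ((\<lambda>a. x \<odot>\<^sub>r\<^bsub>M\<^esub> a) ` carrier R)"
  unfolding right_submodule_def using assms
  by (auto simp: image_iff simp flip: rsmult_r_distr rsmult_assoc intro: bexI[of _ "\<zero>\<^bsub>R\<^esub>"])

text \<open>Maximality among the submodules inside an arbitrary set \<open>P\<close>. The last conclusion is the form in
  which it is applied: whatever can be added without leaving \<open>P\<close> is already there.\<close>

lemma right_submodule_maximal:
  assumes A0: "right_submodule R M A0" "A0 \<subseteq> P"
  obtains A where "right_submodule R M A" "A0 \<subseteq> A" "A \<subseteq> P"
    "\<And>B. \<lbrakk>right_submodule R M B; A <+>\<^bsub>M\<^esub> B \<subseteq> P\<rbrakk> \<Longrightarrow> B \<subseteq> A"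
proof -
  let ?F = "{A. right_submodule R M A \<and> A0 \<subseteq> A \<and> A \<subseteq> P}"
  have "\<exists>A \<in> ?F. \<forall>X \<in> ?F. A \<subseteq> X \<longrightarrow> X = A"
  proof (rule subset_Zorn_nonempty)
    show "?F \<noteq> {}"
      using A0 by blast
    fix \<C> assume ne: "\<C> \<noteq> {}" and ch: "subset.chain ?F \<C>"
    then obtain A1 where A1: "A1 \<in> \<C>" by blast
    have sub: "right_submodule R M A" "A0 \<subseteq> A" "A \<subseteq> P" if "A \<in> \<C>" for A
      using ch that unfolding subset.chain_def by auto
    have add: "x \<oplus>\<^bsub>M\<^esub> y \<in> \<Union>\<C>" if xy: "x \<in> \<Union>\<C>" "y \<in> \<Union>\<C>" for x y
    proof -
      obtain A B where AB: "A \<in> \<C>" "B \<in> \<C>" "x \<in> A" "y \<in> B"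
        using xy by blast
      then have "A \<subseteq> B \<or> B \<subseteq> A"
        using ch unfolding subset_chain_def by blast
      then obtain C where "C \<in> \<C>" "x \<in> C" "y \<in> C"
        using AB by blast
      then show ?thesis
        using right_submoduleD(3)[OF sub(1)] by blast
    qed
    have "right_submodule R M (\<Union>\<C>)"
      using add sub A1 unfolding right_submodule_def by blast
    then show "\<Union>\<C> \<in> ?F"
      using sub A1 by blast
  qed
  then obtain A where A: "right_submodule R M A" "A0 \<subseteq> A" "A \<subseteq> P"
    and max: "\<And>X. \<lbrakk>right_submodule R M X; A0 \<subseteq> X; X \<subseteq> P; A \<subseteq> X\<rbrakk> \<Longrightarrow> X = A"
    by auto
  have "B \<subseteq> A" if "right_submodule R M B" "A <+>\<^bsub>M\<^esub> B \<subseteq> P" for B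
    using max[OF right_submodule_set_add[OF A(1) that(1)]] A(2) that(2)
      subset_right_submodule_set_add[OF A(1) that(1)] by blast
  with A show ?thesis
    using that by blast
qed

text \<open>The last conclusion says that \<open>N + C\<close> is essential: if \<open>X\<close> meets it trivially, then \<open>C + X\<close>
  still meets \<open>N\<close> trivially, so \<open>X \<subseteq> C\<close>.\<close>

lemma maximal_complement:
  assumes N: "right_submodule R M N"
  obtains C where "right_submodule R M C" "N \<inter> C \<subseteq> {\<zero>\<^bsub>M\<^esub>}"
    "\<And>X. \<lbrakk>right_submodule R M X; C \<subseteq> X; N \<inter> X \<subseteq> {\<zero>\<^bsub>M\<^esub>}\<rbrakk> \<Longrightarrow> X = C"
    "\<And>X. \<lbrakk>right_submodule R M X; (N <+>\<^bsub>M\<^esub> C) \<inter> X \<subseteq> {\<zero>\<^bsub>M\<^esub>}\<rbrakk> \<Longrightarrow> X \<subseteq> {\<zero>\<^bsub>M\<^esub>}"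
proof -
  have "right_submodule R M {\<zero>\<^bsub>M\<^esub>}"
    by (simp add: right_submodule_def)
  then obtain C where C: "right_submodule R M C" and CP: "C \<subseteq> - (N - {\<zero>\<^bsub>M\<^esub>})"
    and max: "\<And>B. \<lbrakk>right_submodule R M B; C <+>\<^bsub>M\<^esub> B \<subseteq> - (N - {\<zero>\<^bsub>M\<^esub>})\<rbrakk> \<Longrightarrow> B \<subseteq> C"
    by (rule right_submodule_maximal[where P = "- (N - {\<zero>\<^bsub>M\<^esub>})"]) auto
  have 1: "X = C" if X: "right_submodule R M X" "C \<subseteq> X" "N \<inter> X \<subseteq> {\<zero>\<^bsub>M\<^esub>}" for X
  proof -
    have "C <+>\<^bsub>M\<^esub> X \<subseteq> X"
      using X right_submoduleD(3)[OF X(1)] unfolding subset_iff mem_set_add_iff by blast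
    then show ?thesis
      using max[OF X(1)] X by blast
  qed
  have 2: "X \<subseteq> {\<zero>\<^bsub>M\<^esub>}" if X: "right_submodule R M X" "(N <+>\<^bsub>M\<^esub> C) \<inter> X \<subseteq> {\<zero>\<^bsub>M\<^esub>}" for X
  proof -
    have "C <+>\<^bsub>M\<^esub> X \<subseteq> - (N - {\<zero>\<^bsub>M\<^esub>})"
    proof
      fix z assume "z \<in> C <+>\<^bsub>M\<^esub> X"
      then obtain c x where cx: "c \<in> C" "x \<in> X" "z = c \<oplus>\<^bsub>M\<^esub> x"
        by (auto simp: mem_set_add_iff)
      have carr: "c \<in> carrier M" "x \<in> carrier M"
        using right_submoduleD(1)[OF C cx(1)] right_submoduleD(1)[OF X(1) cx(2)] by auto
      have "z = \<zero>\<^bsub>M\<^esub>" if "z \<in> N"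
      proof -
        have "x = z \<oplus>\<^bsub>M\<^esub> \<ominus>\<^bsub>M\<^esub> c"
          using carr cx(3) by (metis M.a_comm M.add.inv_closed M.add.m_closed M.r_neg1)
        then have "x \<in> N <+>\<^bsub>M\<^esub> C"
          using that right_submodule_minus[OF C cx(1)] by (auto simp: mem_set_add_iff)
        then have "x = \<zero>\<^bsub>M\<^esub>"
          using X(2) cx(2) by blast
        then have "z \<in> C"
          using cx carr by simp
        then show ?thesis
          using that CP by blast
      qed
      then show "z \<in> - (N - {\<zero>\<^bsub>M\<^esub>})" by blast
    qed
    then have "X \<subseteq> C"
      using max X(1) by blast
    then show ?thesis
      using X(2) subset_right_submodule_set_add(2)[OF N C] by blast
  qed
  show ?thesis
    by (rule that[OF C _ 1 2]) (use CP in auto)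
qed

end

section \<open>Extending homomorphisms into an injective module\<close>

lemma right_homI:
  assumes "\<And>x. x \<in> carrier N \<Longrightarrow> f x \<in> carrier M"
    and "\<And>x y. \<lbrakk>x \<in> carrier N; y \<in> carrier N\<rbrakk> \<Longrightarrow> f (x \<oplus>\<^bsub>N\<^esub> y) = f x \<oplus>\<^bsub>M\<^esub> f y"
    and "\<And>x a. \<lbrakk>x \<in> carrier N; a \<in> carrier R\<rbrakk> \<Longrightarrow> f (x \<odot>\<^sub>r\<^bsub>N\<^esub> a) = f x \<odot>\<^sub>r\<^bsub>M\<^esub> a"
  shows "f \<in> right_hom R N M"
  using assms by (auto simp: right_hom_def)

lemma right_homD:
  assumes "f \<in> right_hom R N M"
  shows "x \<in> carrier N \<Longrightarrow> f x \<in> carrier M"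
    and "\<lbrakk>x \<in> carrier N; y \<in> carrier N\<rbrakk> \<Longrightarrow> f (x \<oplus>\<^bsub>N\<^esub> y) = f x \<oplus>\<^bsub>M\<^esub> f y"
    and "\<lbrakk>x \<in> carrier N; a \<in> carrier R\<rbrakk> \<Longrightarrow> f (x \<odot>\<^sub>r\<^bsub>N\<^esub> a) = f x \<odot>\<^sub>r\<^bsub>M\<^esub> a"
  using assms by (auto simp: right_hom_def)

context right_module
begin

lemma right_submodule_prod_diff:
  assumes N: "right_module R N" and G: "right_submodule R (prod_module N M) G"
    and xy: "(x, y) \<in> G" "(x', y') \<in> G"
  shows "(x \<ominus>\<^bsub>N\<^esub> x', y \<ominus>\<^bsub>M\<^esub> y') \<in> G"
proof -
  interpret N: right_module R N by fact
  note GD = right_submodule_prodD[OF G]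
  have "(x' \<odot>\<^sub>r\<^bsub>N\<^esub> (\<ominus>\<^bsub>R\<^esub> \<one>\<^bsub>R\<^esub>), y' \<odot>\<^sub>r\<^bsub>M\<^esub> (\<ominus>\<^bsub>R\<^esub> \<one>\<^bsub>R\<^esub>)) \<in> G"
    using xy by (intro GD(5)) auto
  then have "(\<ominus>\<^bsub>N\<^esub> x', \<ominus>\<^bsub>M\<^esub> y') \<in> G"
    using GD(1,2)[OF xy(2)] by (simp add: rsmult_minus_one N.rsmult_minus_one)
  then show ?thesis
    using GD(4)[OF xy(1)] by (simp add: a_minus_def)
qed

text \<open>Baer's criterion, for a homomorphism on a submodule of \<open>N\<close> given by its graph \<open>G\<close>. A maximal graph
  is total: for \<open>m \<in> N\<close>, the scalars that bring \<open>m\<close> into its domain form a right ideal, and injectivity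
  supplies a value \<open>n\<close> at \<open>m\<close> that is compatible with the graph.\<close>

lemma injective_module_extend:
  assumes inj: "injective_module R M" and N: "right_module R N"
    and G: "right_submodule R (prod_module N M) G"
    and fn: "\<And>y. (\<zero>\<^bsub>N\<^esub>, y) \<in> G \<Longrightarrow> y = \<zero>\<^bsub>M\<^esub>"
  obtains f where "f \<in> right_hom R N M" "\<And>x y. (x, y) \<in> G \<Longrightarrow> f x = y"
proof -
  interpret N: right_module R N by fact
  interpret P: right_module R "prod_module N M"
    by (rule right_module_prod_module[OF N right_module_axioms])
  define P where "P = {p :: 'c \<times> 'b. fst p = \<zero>\<^bsub>N\<^esub> \<longrightarrow> snd p = \<zero>\<^bsub>M\<^esub>}"
  have "G \<subseteq> P"
    using fn by (auto simp: P_def)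
  then obtain H where H: "right_submodule R (prod_module N M) H" and "G \<subseteq> H" "H \<subseteq> P"
    and max: "\<And>B. \<lbrakk>right_submodule R (prod_module N M) B; H <+>\<^bsub>prod_module N M\<^esub> B \<subseteq> P\<rbrakk> \<Longrightarrow> B \<subseteq> H"
    using P.right_submodule_maximal[OF G] by metis
  note HD = right_submodule_prodD[OF H]
  have fnH: "y = \<zero>\<^bsub>M\<^esub>" if "(\<zero>\<^bsub>N\<^esub>, y) \<in> H" for y
    using that \<open>H \<subseteq> P\<close> by (auto simp: P_def)
  have uniq: "y = y'" if "(x, y) \<in> H" "(x, y') \<in> H" for x y y'
  proof -
    have "(\<zero>\<^bsub>N\<^esub>, y \<ominus>\<^bsub>M\<^esub> y') \<in> H"
      using right_submodule_prod_diff[OF N H that] HD(1)[OF that(1)]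
      by (simp add: a_minus_def N.M.r_neg)
    then show ?thesis
      using fnH HD(2) that by (metis M.diff_eq_zero_iff)
  qed
  have the: "(THE y. (x, y) \<in> H) = y" if "(x, y) \<in> H" for x y
    using that uniq by blast
  have total: "\<exists>n. (m, n) \<in> H" if m: "m \<in> carrier N" for m
  proof -
    define I where "I = {r \<in> carrier R. \<exists>y. (m \<odot>\<^sub>r\<^bsub>N\<^esub> r, y) \<in> H}"
    define f where "f r = (THE y. (m \<odot>\<^sub>r\<^bsub>N\<^esub> r, y) \<in> H)" for r
    have fI: "(m \<odot>\<^sub>r\<^bsub>N\<^esub> r, f r) \<in> H" if "r \<in> I" for r
      using that the by (auto simp: f_def I_def)
    have I_add: "r \<oplus>\<^bsub>R\<^esub> s \<in> I \<and> f (r \<oplus>\<^bsub>R\<^esub> s) = f r \<oplus>\<^bsub>M\<^esub> f s" if "r \<in> I" "s \<in> I" for r s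
    proof -
      have "(m \<odot>\<^sub>r\<^bsub>N\<^esub> (r \<oplus>\<^bsub>R\<^esub> s), f r \<oplus>\<^bsub>M\<^esub> f s) \<in> H"
        using HD(4)[OF fI[OF that(1)] fI[OF that(2)]] that m by (simp add: I_def N.rsmult_r_distr)
      with that show ?thesis
        using the by (auto simp: I_def f_def)
    qed
    have I_mult: "r \<otimes>\<^bsub>R\<^esub> s \<in> I \<and> f (r \<otimes>\<^bsub>R\<^esub> s) = f r \<odot>\<^sub>r\<^bsub>M\<^esub> s" if "r \<in> I" "s \<in> carrier R" for r s
    proof -
      have "(m \<odot>\<^sub>r\<^bsub>N\<^esub> (r \<otimes>\<^bsub>R\<^esub> s), f r \<odot>\<^sub>r\<^bsub>M\<^esub> s) \<in> H"
        using HD(5)[OF fI[OF that(1)] that(2)] that m by (simp add: I_def N.rsmult_assoc)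
      with that show ?thesis
        using the by (auto simp: I_def f_def)
    qed
    have "I \<subseteq> carrier R"
      by (auto simp: I_def)
    have "\<zero>\<^bsub>R\<^esub> \<in> I"
      using m HD(3) by (auto simp: I_def)
    have "\<ominus>\<^bsub>R\<^esub> r \<in> I" if "r \<in> I" for r
      using I_mult[OF that, of "\<ominus>\<^bsub>R\<^esub> \<one>\<^bsub>R\<^esub>"] that \<open>I \<subseteq> carrier R\<close> by (auto simp: R.r_minus)
    then have "subgroup I (add_monoid R)"
      using I_add \<open>I \<subseteq> carrier R\<close> \<open>\<zero>\<^bsub>R\<^esub> \<in> I\<close> by (intro R.add.subgroupI) (auto simp: a_inv_def)
    then have I: "right_ideal I R"
      using I_mult by (simp add: right_ideal_def additive_subgroup_def)
    have "f \<in> right_hom R (ideal_module R I) M"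
      using I_add I_mult HD(2)[OF fI] by (intro right_homI) (simp_all add: ideal_module_def)
    then obtain g where g: "g \<in> right_hom R (ideal_module R (carrier R)) M"
      and gf: "\<And>r. r \<in> I \<Longrightarrow> g r = f r"
      using inj I unfolding injective_module_def by blast
    define n where "n = g \<one>\<^bsub>R\<^esub>"
    have n: "n \<in> carrier M"
      using right_homD(1)[OF g] by (simp add: n_def ideal_module_def)
    have gn: "g r = n \<odot>\<^sub>r\<^bsub>M\<^esub> r" if "r \<in> carrier R" for r
      using right_homD(3)[OF g, of "\<one>\<^bsub>R\<^esub>" r] that by (simp add: n_def ideal_module_def)
    let ?B = "(\<lambda>a. (m, n) \<odot>\<^sub>r\<^bsub>prod_module N M\<^esub> a) ` carrier R"
    have "H <+>\<^bsub>prod_module N M\<^esub> ?B \<subseteq> P"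
    proof
      fix p assume "p \<in> H <+>\<^bsub>prod_module N M\<^esub> ?B"
      then obtain x y r where xy: "(x, y) \<in> H" and r: "r \<in> carrier R"
        and p: "p = (x \<oplus>\<^bsub>N\<^esub> m \<odot>\<^sub>r\<^bsub>N\<^esub> r, y \<oplus>\<^bsub>M\<^esub> n \<odot>\<^sub>r\<^bsub>M\<^esub> r)"
        by (auto simp: mem_set_add_iff)
      have "y \<oplus>\<^bsub>M\<^esub> n \<odot>\<^sub>r\<^bsub>M\<^esub> r = \<zero>\<^bsub>M\<^esub>" if "x \<oplus>\<^bsub>N\<^esub> m \<odot>\<^sub>r\<^bsub>N\<^esub> r = \<zero>\<^bsub>N\<^esub>"
      proof -
        have "m \<odot>\<^sub>r\<^bsub>N\<^esub> r = \<ominus>\<^bsub>N\<^esub> x"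
          using that HD(1)[OF xy] m r
          by (metis N.M.a_comm N.M.minus_equality N.rsmult_closed)
        moreover have "(\<ominus>\<^bsub>N\<^esub> x, \<ominus>\<^bsub>M\<^esub> y) \<in> H"
          using right_submodule_prod_diff[OF N H HD(3) xy] HD(1,2)[OF xy] by (simp add: a_minus_def)
        ultimately have *: "(m \<odot>\<^sub>r\<^bsub>N\<^esub> r, \<ominus>\<^bsub>M\<^esub> y) \<in> H"
          by simp
        then have "r \<in> I"
          using r by (auto simp: I_def)
        then have "n \<odot>\<^sub>r\<^bsub>M\<^esub> r = \<ominus>\<^bsub>M\<^esub> y"
          using gn[OF r] gf the[OF *] by (simp add: f_def)
        then show ?thesis
          using HD(2)[OF xy] by (simp add: M.r_neg)
      qed
      with p show "p \<in> P"
        by (auto simp: P_def)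
    qed
    then have "?B \<subseteq> H"
      using max P.right_submodule_cyclic[of "(m, n)"] m n by auto
    then have "(m, n) \<odot>\<^sub>r\<^bsub>prod_module N M\<^esub> \<one>\<^bsub>R\<^esub> \<in> H"
      by blast
    then show ?thesis
      using m n by auto
  qed
  define f where "f x = (THE y. (x, y) \<in> H)" for x
  have fH: "f x = y" if "(x, y) \<in> H" for x y
    using the[OF that] by (simp add: f_def)
  have fH': "(x, f x) \<in> H" if "x \<in> carrier N" for x
    using total[OF that] fH by auto
  have "f \<in> right_hom R N M"
    using HD(2)[OF fH'] HD(4)[OF fH' fH', THEN fH] HD(5)[OF fH', THEN fH] by (intro right_homI) auto
  then show ?thesis
    using that fH \<open>G \<subseteq> H\<close> by blast
qed

lemma endo_zero: "f \<in> right_hom R M M \<Longrightarrow> f \<zero>\<^bsub>M\<^esub> = \<zero>\<^bsub>M\<^esub>"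
  using right_homD(3)[of f R M M "\<zero>\<^bsub>M\<^esub>" "\<zero>\<^bsub>R\<^esub>"] right_homD(1)[of f R M M "\<zero>\<^bsub>M\<^esub>"] by simp

lemma endo_minus:
  assumes "f \<in> right_hom R M M" "x \<in> carrier M"
  shows "f (\<ominus>\<^bsub>M\<^esub> x) = \<ominus>\<^bsub>M\<^esub> f x"
  using right_homD(3)[OF assms, of "\<ominus>\<^bsub>R\<^esub> \<one>\<^bsub>R\<^esub>"] right_homD(1)[OF assms] assms
  by (simp add: rsmult_minus_one)

lemma right_submodule_zero: "right_submodule R M {\<zero>\<^bsub>M\<^esub>}"
  by (simp add: right_submodule_def)

lemma right_submodule_vimage:
  assumes "f \<in> right_hom R M M" "right_submodule R M A"
  shows "right_submodule R M {x \<in> carrier M. f x \<in> A}"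
  unfolding right_submodule_def
  using right_submoduleD[OF assms(2)] right_homD[OF assms(1)] endo_zero[OF assms(1)] by auto

lemma right_submodule_kernel:
  assumes "f \<in> right_hom R M M"
  shows "right_submodule R M {x \<in> carrier M. f x = \<zero>\<^bsub>M\<^esub>}"
  using right_submodule_vimage[OF assms right_submodule_zero] by simp

lemma right_submodule_image:
  assumes f: "f \<in> right_hom R M M" and A: "right_submodule R M A"
  shows "right_submodule R M (f ` A)"
proof -
  note AD = right_submoduleD[OF A] and fD = right_homD[OF f]
  have "f x \<oplus>\<^bsub>M\<^esub> f y \<in> f ` A" if "x \<in> A" "y \<in> A" for x y
    using that AD fD(2)[of x y] by (metis imageI)
  moreover have "f x \<odot>\<^sub>r\<^bsub>M\<^esub> a \<in> f ` A" if "x \<in> A" "a \<in> carrier R" for x a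
    using that AD fD(3)[of x a] by (metis imageI)
  moreover have "\<zero>\<^bsub>M\<^esub> \<in> f ` A"
    using AD(2) endo_zero[OF f] by (metis imageI)
  ultimately show ?thesis
    unfolding right_submodule_def using fD(1) AD(1) by auto
qed

lemma right_hom_funpow: "f \<in> right_hom R M M \<Longrightarrow> f ^^ n \<in> right_hom R M M"
proof (induction n)
  case (Suc n)
  note fD = right_homD[OF Suc.prems] and nD = right_homD[OF Suc.IH[OF Suc.prems]]
  show ?case
    by (rule right_homI) (simp_all add: fD nD)
qed (simp add: right_hom_def)

end

section \<open>Submodules without isomorphic parts\<close>

definition partial_isomorphism ::
  "('a, 'r) ring_scheme \<Rightarrow> ('a, 'b, 'm) right_module_scheme \<Rightarrow> ('b \<times> 'b) set \<Rightarrow> bool"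
  where "partial_isomorphism R M G \<longleftrightarrow>
    right_submodule R (prod_module M M) G \<and> (\<forall>(x, y) \<in> G. x = \<zero>\<^bsub>M\<^esub> \<longleftrightarrow> y = \<zero>\<^bsub>M\<^esub>)"

text \<open>No nonzero submodule of \<open>A\<close> is isomorphic to a submodule of \<open>B\<close>.\<close>

definition orthogonal ::
  "('a, 'r) ring_scheme \<Rightarrow> ('a, 'b, 'm) right_module_scheme \<Rightarrow> 'b set \<Rightarrow> 'b set \<Rightarrow> bool"
  where "orthogonal R M A B \<longleftrightarrow>
    (\<forall>G. partial_isomorphism R M G \<longrightarrow> G \<subseteq> A \<times> B \<longrightarrow> G \<subseteq> {(\<zero>\<^bsub>M\<^esub>, \<zero>\<^bsub>M\<^esub>)})"

definition co_hopfian ::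
  "('a, 'r) ring_scheme \<Rightarrow> ('a, 'b, 'm) right_module_scheme \<Rightarrow> bool"
  where "co_hopfian R M \<longleftrightarrow>
    (\<forall>v \<in> right_hom R M M. (\<forall>x \<in> carrier M. v x = \<zero>\<^bsub>M\<^esub> \<longrightarrow> x = \<zero>\<^bsub>M\<^esub>) \<longrightarrow> carrier M \<subseteq> v ` carrier M)"

lemma orthogonalD:
  assumes "orthogonal R M A B" "partial_isomorphism R M G" "G \<subseteq> A \<times> B" "(x, y) \<in> G"
  shows "x = \<zero>\<^bsub>M\<^esub>" "y = \<zero>\<^bsub>M\<^esub>"
  using assms unfolding orthogonal_def by blast+

context right_module
begin

lemma partial_isomorphism_restrict:
  assumes G: "partial_isomorphism R M G" and B: "right_submodule R M B"
  shows "partial_isomorphism R M (G \<inter> UNIV \<times> B)"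
proof -
  have G': "right_submodule R (prod_module M M) G"
    using G by (simp add: partial_isomorphism_def)
  have "right_submodule R (prod_module M M) (G \<inter> UNIV \<times> B)"
    using right_submodule_prodD[OF G'] right_submoduleD[OF B] by (intro right_submodule_prodI) auto
  then show ?thesis
    using G by (auto simp: partial_isomorphism_def)
qed

text \<open>An isomorphism from a submodule of \<open>E\<close> into \<open>ker t\<^sup>n\<^sup>+\<^sup>1\<close> takes no nonzero element into
  \<open>ker t\<^sup>n\<close>, by induction. Hence it stays injective when followed by \<open>t\<^sup>n\<close>, which carries it into
  \<open>ker t\<close>.\<close>

lemma orthogonal_kernel_funpow:
  assumes t: "t \<in> right_hom R M M" and orth: "orthogonal R M E {x \<in> carrier M. t x = \<zero>\<^bsub>M\<^esub>}"
  shows "orthogonal R M E {x \<in> carrier M. (t ^^ n) x = \<zero>\<^bsub>M\<^esub>}"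
proof (induction n)
  case 0
  show ?case
    unfolding orthogonal_def partial_isomorphism_def by fastforce
next
  case (Suc n)
  let ?K = "\<lambda>n. {x \<in> carrier M. (t ^^ n) x = \<zero>\<^bsub>M\<^esub>}"
  note tn = right_hom_funpow[OF t, of n]
  show ?case
    unfolding orthogonal_def
  proof (intro allI impI)
    fix G assume G: "partial_isomorphism R M G" and GEK: "G \<subseteq> E \<times> ?K (Suc n)"
    have G': "right_submodule R (prod_module M M) G"
      using G by (simp add: partial_isomorphism_def)
    have iso: "x = \<zero>\<^bsub>M\<^esub> \<longleftrightarrow> y = \<zero>\<^bsub>M\<^esub>" if "(x, y) \<in> G" for x y
      using G that by (auto simp: partial_isomorphism_def)
    note GD = right_submodule_prodD[OF G']
    have low: "x = \<zero>\<^bsub>M\<^esub>" if xy: "(x, y) \<in> G" "(t ^^ n) y = \<zero>\<^bsub>M\<^esub>" for x y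
    proof (rule orthogonalD(1)[OF Suc])
      show "partial_isomorphism R M (G \<inter> UNIV \<times> ?K n)"
        by (intro partial_isomorphism_restrict G right_submodule_kernel tn)
      show "G \<inter> UNIV \<times> ?K n \<subseteq> E \<times> ?K n"
        using GEK by blast
      show "(x, y) \<in> G \<inter> UNIV \<times> ?K n"
        using xy GD(2) by simp
    qed
    define G2 where "G2 = {(x, (t ^^ n) y) | x y. (x, y) \<in> G}"
    have "right_submodule R (prod_module M M) G2"
    proof (rule right_submodule_prodI)
      show "(\<zero>\<^bsub>M\<^esub>, \<zero>\<^bsub>M\<^esub>) \<in> G2"
        using GD(3) endo_zero[OF tn] unfolding G2_def by force
      fix x z assume "(x, z) \<in> G2"
      then obtain y where y: "(x, y) \<in> G" "z = (t ^^ n) y"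
        by (auto simp: G2_def)
      show "x \<in> carrier M \<and> z \<in> carrier M"
        using GD(1,2)[OF y(1)] right_homD(1)[OF tn] y(2) by simp
      show "(x \<odot>\<^sub>r\<^bsub>M\<^esub> a, z \<odot>\<^sub>r\<^bsub>M\<^esub> a) \<in> G2" if "a \<in> carrier R" for a
        using GD(5)[OF y(1) that] right_homD(3)[OF tn GD(2)[OF y(1)] that] y(2)
        unfolding G2_def by force
      fix x' z' assume "(x', z') \<in> G2"
      then obtain y' where y': "(x', y') \<in> G" "z' = (t ^^ n) y'"
        by (auto simp: G2_def)
      show "(x \<oplus>\<^bsub>M\<^esub> x', z \<oplus>\<^bsub>M\<^esub> z') \<in> G2"
        using GD(4)[OF y(1) y'(1)] right_homD(2)[OF tn GD(2)[OF y(1)] GD(2)[OF y'(1)]] y(2) y'(2)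
        unfolding G2_def by force
    qed
    then have "partial_isomorphism R M G2"
      using low iso endo_zero[OF tn] unfolding partial_isomorphism_def by (auto simp: G2_def)
    moreover have "G2 \<subseteq> E \<times> {x \<in> carrier M. t x = \<zero>\<^bsub>M\<^esub>}"
      using GEK right_homD(1)[OF tn] unfolding G2_def by auto
    ultimately have "x = \<zero>\<^bsub>M\<^esub>" if "(x, y) \<in> G" for x y
      using orthogonalD(1)[OF orth] that unfolding G2_def by blast
    then show "G \<subseteq> {(\<zero>\<^bsub>M\<^esub>, \<zero>\<^bsub>M\<^esub>)}"
      using iso by auto
  qed
qed

text \<open>A cancellation principle: in a co-Hopfian module, what the image of \<open>t\<close> misses has to be compensated
  by the kernel of \<open>t\<close>. Replacing \<open>t\<close> by the identity on its generalised kernel \<open>K\<close> makes it injective;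
  if \<open>E\<close> has nothing in common with \<open>ker t\<close>, hence nothing with \<open>K\<close>, the modified map still misses
  \<open>E\<close>.\<close>

lemma co_hopfian_cokernel_trivial:
  assumes inj: "injective_module R M" and coh: "co_hopfian R M"
    and t: "t \<in> right_hom R M M" and E: "right_submodule R M E"
    and Et: "\<And>x. \<lbrakk>x \<in> carrier M; t x \<in> E\<rbrakk> \<Longrightarrow> t x = \<zero>\<^bsub>M\<^esub>"
    and orth: "orthogonal R M E {x \<in> carrier M. t x = \<zero>\<^bsub>M\<^esub>}"
  shows "E \<subseteq> {\<zero>\<^bsub>M\<^esub>}"
proof -
  define K where "K = {x \<in> carrier M. \<exists>n. (t ^^ n) x = \<zero>\<^bsub>M\<^esub>}"
  note tD = right_homD[OF t] and tn = right_hom_funpow[OF t]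
  have later: "(t ^^ (n + k)) x = \<zero>\<^bsub>M\<^esub>" if "(t ^^ n) x = \<zero>\<^bsub>M\<^esub>" for n k x
    using that endo_zero[OF tn[of k]] by (simp add: funpow_add add.commute[of n])
  have K: "right_submodule R M K"
    unfolding right_submodule_def
  proof (intro conjI ballI)
    show "K \<subseteq> carrier M" "\<zero>\<^bsub>M\<^esub> \<in> K"
      by (auto simp: K_def intro: exI[of _ 0])
    fix x assume "x \<in> K"
    then obtain n where x: "x \<in> carrier M" "(t ^^ n) x = \<zero>\<^bsub>M\<^esub>"
      by (auto simp: K_def)
    show "x \<odot>\<^sub>r\<^bsub>M\<^esub> a \<in> K" if "a \<in> carrier R" for a
      using x that right_homD(3)[OF tn[of n] x(1) that] by (auto simp: K_def intro!: exI[of _ n])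
    fix y assume "y \<in> K"
    then obtain m where y: "y \<in> carrier M" "(t ^^ m) y = \<zero>\<^bsub>M\<^esub>"
      by (auto simp: K_def)
    have "(t ^^ (n + m)) x = \<zero>\<^bsub>M\<^esub>" "(t ^^ (n + m)) y = \<zero>\<^bsub>M\<^esub>"
      using later[OF x(2), of m] later[OF y(2), of n] by (simp_all add: add.commute)
    then show "x \<oplus>\<^bsub>M\<^esub> y \<in> K"
      using x(1) y(1) right_homD(2)[OF tn[of "n + m"] x(1) y(1)]
      by (auto simp: K_def intro!: exI[of _ "n + m"])
  qed
  note KD = right_submoduleD[OF K]
  have Kt: "x \<in> K" if "x \<in> carrier M" "t x \<in> K" for x
  proof -
    obtain n where "(t ^^ n) (t x) = \<zero>\<^bsub>M\<^esub>"
      using \<open>t x \<in> K\<close> unfolding K_def by blast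
    then have "(t ^^ Suc n) x = \<zero>\<^bsub>M\<^esub>"
      by (simp add: funpow_swap1)
    then show ?thesis
      using that(1) unfolding K_def by blast
  qed
  obtain H where H: "right_submodule R M H" and KH: "K \<inter> H \<subseteq> {\<zero>\<^bsub>M\<^esub>}"
    and ess: "\<And>X. \<lbrakk>right_submodule R M X; (K <+>\<^bsub>M\<^esub> H) \<inter> X \<subseteq> {\<zero>\<^bsub>M\<^esub>}\<rbrakk> \<Longrightarrow> X \<subseteq> {\<zero>\<^bsub>M\<^esub>}"
    using maximal_complement[OF K] by metis
  note HD = right_submoduleD[OF H]
  have minusK: "x \<in> K" if "x \<oplus>\<^bsub>M\<^esub> k = \<zero>\<^bsub>M\<^esub>" "k \<in> K" "x \<in> carrier M" for x k
    using right_submodule_minus[OF K that(2)] M.minus_equality[OF that(1) KD(1)[OF that(2)] that(3)]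
    by simp
  have th_k: "h = \<zero>\<^bsub>M\<^esub> \<and> k = \<zero>\<^bsub>M\<^esub>" if "t h \<oplus>\<^bsub>M\<^esub> k = \<zero>\<^bsub>M\<^esub>" "h \<in> H" "k \<in> K" for h k
  proof -
    have "h \<in> K"
      by (rule Kt[OF HD(1)[OF that(2)] minusK[OF that(1,3) tD(1)[OF HD(1)[OF that(2)]]]])
    then have "h = \<zero>\<^bsub>M\<^esub>"
      using KH that(2) by blast
    then show ?thesis
      using that(1) KD(1)[OF that(3)] endo_zero[OF t] by simp
  qed
  have h_k: "h = \<zero>\<^bsub>M\<^esub> \<and> k = \<zero>\<^bsub>M\<^esub>" if "h \<oplus>\<^bsub>M\<^esub> k = \<zero>\<^bsub>M\<^esub>" "h \<in> H" "k \<in> K" for h k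
  proof -
    have "h = \<zero>\<^bsub>M\<^esub>"
      using minusK[OF that(1,3) HD(1)[OF that(2)]] KH that(2) by blast
    then show ?thesis
      using that(1) KD(1)[OF that(3)] by simp
  qed
  \<comment> \<open>the graph of \<open>t\<close> on \<open>H\<close> and the identity on \<open>K\<close>; \<open>th_k\<close> is its injectivity\<close>
  define G where "G = {(h \<oplus>\<^bsub>M\<^esub> k, t h \<oplus>\<^bsub>M\<^esub> k) | h k. h \<in> H \<and> k \<in> K}"
  have "right_submodule R (prod_module M M) G"
  proof (rule right_submodule_prodI)
    show "(\<zero>\<^bsub>M\<^esub>, \<zero>\<^bsub>M\<^esub>) \<in> G"
      using HD(2) KD(2) endo_zero[OF t] unfolding G_def by force
    fix x z assume "(x, z) \<in> G"
    then obtain h k where hk: "h \<in> H" "k \<in> K" and xz: "x = h \<oplus>\<^bsub>M\<^esub> k" "z = t h \<oplus>\<^bsub>M\<^esub> k"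
      by (auto simp: G_def)
    note c = HD(1)[OF hk(1)] KD(1)[OF hk(2)] tD(1)[OF HD(1)[OF hk(1)]]
    show "x \<in> carrier M \<and> z \<in> carrier M"
      using c xz by simp
    show "(x \<odot>\<^sub>r\<^bsub>M\<^esub> a, z \<odot>\<^sub>r\<^bsub>M\<^esub> a) \<in> G" if "a \<in> carrier R" for a
      unfolding G_def mem_Collect_eq
      using c xz that HD(4)[OF hk(1)] KD(4)[OF hk(2)]
      by (intro exI[of _ "h \<odot>\<^sub>r\<^bsub>M\<^esub> a"] exI[of _ "k \<odot>\<^sub>r\<^bsub>M\<^esub> a"]) (simp add: rsmult_l_distr tD(3))
    fix x' z' assume "(x', z') \<in> G"
    then obtain h' k' where hk': "h' \<in> H" "k' \<in> K" and xz': "x' = h' \<oplus>\<^bsub>M\<^esub> k'" "z' = t h' \<oplus>\<^bsub>M\<^esub> k'"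
      by (auto simp: G_def)
    note c' = HD(1)[OF hk'(1)] KD(1)[OF hk'(2)] tD(1)[OF HD(1)[OF hk'(1)]]
    show "(x \<oplus>\<^bsub>M\<^esub> x', z \<oplus>\<^bsub>M\<^esub> z') \<in> G"
      unfolding G_def mem_Collect_eq
      using c xz c' xz' HD(3)[OF hk(1) hk'(1)] KD(3)[OF hk(2) hk'(2)]
      by (intro exI[of _ "h \<oplus>\<^bsub>M\<^esub> h'"] exI[of _ "k \<oplus>\<^bsub>M\<^esub> k'"]) (simp add: M.a_ac tD(2))
  qed
  moreover have "y = \<zero>\<^bsub>M\<^esub>" if zy: "(\<zero>\<^bsub>M\<^esub>, y) \<in> G" for y
  proof -
    obtain h k where hk: "h \<in> H" "k \<in> K" "h \<oplus>\<^bsub>M\<^esub> k = \<zero>\<^bsub>M\<^esub>" and y: "y = t h \<oplus>\<^bsub>M\<^esub> k"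
      using zy unfolding G_def by auto
    then show ?thesis
      using h_k[OF hk(3,1,2)] endo_zero[OF t] by simp
  qed
  ultimately obtain v where v: "v \<in> right_hom R M M" and vG: "\<And>x y. (x, y) \<in> G \<Longrightarrow> v x = y"
    using injective_module_extend[OF inj right_module_axioms] by metis
  have vhk: "v (h \<oplus>\<^bsub>M\<^esub> k) = t h \<oplus>\<^bsub>M\<^esub> k" if "h \<in> H" "k \<in> K" for h k
    using vG that unfolding G_def by blast
  have KH_v: "\<exists>h\<in>H. \<exists>k\<in>K. x = h \<oplus>\<^bsub>M\<^esub> k \<and> v x = t h \<oplus>\<^bsub>M\<^esub> k" if "x \<in> K <+>\<^bsub>M\<^esub> H" for x
  proof -
    obtain k h where hk: "k \<in> K" "h \<in> H" and "x = k \<oplus>\<^bsub>M\<^esub> h"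
      using \<open>x \<in> _\<close> unfolding mem_set_add_iff by blast
    then have "x = h \<oplus>\<^bsub>M\<^esub> k"
      using HD(1)[OF hk(2)] KD(1)[OF hk(1)] by (simp add: M.a_comm)
    then show ?thesis
      using hk vhk by blast
  qed
  have KH0: "x = \<zero>\<^bsub>M\<^esub>" if "x \<in> K <+>\<^bsub>M\<^esub> H" "v x = \<zero>\<^bsub>M\<^esub>" for x
  proof -
    obtain h k where hk: "h \<in> H" "k \<in> K" "x = h \<oplus>\<^bsub>M\<^esub> k" "v x = t h \<oplus>\<^bsub>M\<^esub> k"
      using KH_v[OF \<open>x \<in> _\<close>] by blast
    then have "h = \<zero>\<^bsub>M\<^esub> \<and> k = \<zero>\<^bsub>M\<^esub>"
      using that(2) by (intro th_k) simp_all
    then show ?thesis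
      using hk(3) by simp
  qed
  have "(K <+>\<^bsub>M\<^esub> H) \<inter> {x \<in> carrier M. v x = \<zero>\<^bsub>M\<^esub>} \<subseteq> {\<zero>\<^bsub>M\<^esub>}"
    using KH0 by blast
  then have "{x \<in> carrier M. v x = \<zero>\<^bsub>M\<^esub>} \<subseteq> {\<zero>\<^bsub>M\<^esub>}"
    by (rule ess[OF right_submodule_kernel[OF v]])
  then have surj: "carrier M \<subseteq> v ` carrier M"
    using coh v unfolding co_hopfian_def by blast

  \<comment> \<open>the embedding of \<open>E \<inter> (t H + K)\<close> into \<open>K\<close>\<close>
  define F where "F = {(e, k). e \<in> E \<and> k \<in> K \<and> (\<exists>h\<in>H. e = t h \<oplus>\<^bsub>M\<^esub> k)}"
  have Fsub: "right_submodule R (prod_module M M) F"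
  proof (rule right_submodule_prodI)
    show "(\<zero>\<^bsub>M\<^esub>, \<zero>\<^bsub>M\<^esub>) \<in> F"
      using HD(2) KD(2) right_submoduleD(2)[OF E] endo_zero[OF t]
      by (auto simp: F_def intro!: bexI[of _ "\<zero>\<^bsub>M\<^esub>"])
    fix e k assume "(e, k) \<in> F"
    then obtain h where hk: "h \<in> H" "k \<in> K" "e \<in> E" and e: "e = t h \<oplus>\<^bsub>M\<^esub> k"
      by (auto simp: F_def)
    note c = HD(1)[OF hk(1)] KD(1)[OF hk(2)] tD(1)[OF HD(1)[OF hk(1)]]
    show "e \<in> carrier M \<and> k \<in> carrier M"
      using c e by simp
    show "(e \<odot>\<^sub>r\<^bsub>M\<^esub> a, k \<odot>\<^sub>r\<^bsub>M\<^esub> a) \<in> F" if "a \<in> carrier R" for a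
    proof -
      have "e \<odot>\<^sub>r\<^bsub>M\<^esub> a = t (h \<odot>\<^sub>r\<^bsub>M\<^esub> a) \<oplus>\<^bsub>M\<^esub> k \<odot>\<^sub>r\<^bsub>M\<^esub> a"
        using c e that by (simp add: rsmult_l_distr tD(3))
      then show ?thesis
        using that HD(4)[OF hk(1)] KD(4)[OF hk(2)] right_submoduleD(4)[OF E hk(3)]
        unfolding F_def mem_Collect_eq prod.case by blast
    qed
    fix e' k' assume "(e', k') \<in> F"
    then obtain h' where hk': "h' \<in> H" "k' \<in> K" "e' \<in> E" and e': "e' = t h' \<oplus>\<^bsub>M\<^esub> k'"
      by (auto simp: F_def)
    note c' = HD(1)[OF hk'(1)] KD(1)[OF hk'(2)] tD(1)[OF HD(1)[OF hk'(1)]]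
    have "e \<oplus>\<^bsub>M\<^esub> e' = t (h \<oplus>\<^bsub>M\<^esub> h') \<oplus>\<^bsub>M\<^esub> (k \<oplus>\<^bsub>M\<^esub> k')"
      using c e c' e' by (simp add: M.a_ac tD(2))
    then show "(e \<oplus>\<^bsub>M\<^esub> e', k \<oplus>\<^bsub>M\<^esub> k') \<in> F"
      using HD(3)[OF hk(1) hk'(1)] KD(3)[OF hk(2) hk'(2)] right_submoduleD(3)[OF E hk(3) hk'(3)]
      unfolding F_def mem_Collect_eq prod.case by blast
  qed
  have Fiso: "e = \<zero>\<^bsub>M\<^esub> \<longleftrightarrow> k = \<zero>\<^bsub>M\<^esub>" if "(e, k) \<in> F" for e k
  proof -
    obtain h where h: "h \<in> H" "k \<in> K" "e \<in> E" and e: "e = t h \<oplus>\<^bsub>M\<^esub> k"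
      using \<open>(e, k) \<in> F\<close> by (auto simp: F_def)
    show ?thesis
      using th_k[of h k] e h Et[of h] HD(1)[OF h(1)] tD(1)[OF HD(1)[OF h(1)]] by auto
  qed
  have Fpi: "partial_isomorphism R M F"
    using Fsub Fiso by (auto simp: partial_isomorphism_def)
  have F0: "e = \<zero>\<^bsub>M\<^esub>" if ek: "(e, k) \<in> F" for e k
  proof -
    obtain n where n: "(t ^^ n) k = \<zero>\<^bsub>M\<^esub>" and k: "k \<in> carrier M"
      using ek by (auto simp: F_def K_def)
    let ?K = "{x \<in> carrier M. (t ^^ n) x = \<zero>\<^bsub>M\<^esub>}"
    show ?thesis
    proof (rule orthogonalD(1)[OF orthogonal_kernel_funpow[OF t orth, of n]])
      show "partial_isomorphism R M (F \<inter> UNIV \<times> ?K)"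
        by (intro partial_isomorphism_restrict Fpi right_submodule_kernel tn)
      show "F \<inter> UNIV \<times> ?K \<subseteq> E \<times> ?K"
        by (auto simp: F_def)
      show "(e, k) \<in> F \<inter> UNIV \<times> ?K"
        using ek n k by simp
    qed
  qed
  \<comment> \<open>\<open>E\<close> meets \<open>t H + K\<close> trivially; pull this back along the automorphism \<open>v\<close>\<close>
  have vE: "{x \<in> carrier M. v x \<in> E} \<subseteq> {\<zero>\<^bsub>M\<^esub>}"
  proof (rule ess[OF right_submodule_vimage[OF v E]], rule subsetI)
    fix x assume x: "x \<in> (K <+>\<^bsub>M\<^esub> H) \<inter> {x \<in> carrier M. v x \<in> E}"
    then obtain h k where "h \<in> H" "k \<in> K" "v x = t h \<oplus>\<^bsub>M\<^esub> k"
      using KH_v by blast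
    then have "(v x, k) \<in> F"
      using x by (auto simp: F_def)
    then have "v x = \<zero>\<^bsub>M\<^esub>"
      by (rule F0)
    then show "x \<in> {\<zero>\<^bsub>M\<^esub>}"
      using KH0 x by blast
  qed
  show ?thesis
  proof
    fix e assume e: "e \<in> E"
    then obtain x where "x \<in> carrier M" "e = v x"
      using surj right_submoduleD(1)[OF E e] by blast
    then show "e \<in> {\<zero>\<^bsub>M\<^esub>}"
      using vE e endo_zero[OF v] by auto
  qed
qed

text \<open>The maximal pair \<open>(D, x)\<close> is encoded by the graph of \<open>x\<close> on \<open>D\<close>, a maximal submodule of
  \<open>M \<times> M\<close> inside the set \<open>P\<close>: one condition in \<open>P\<close> makes it single-valued, the other makes
  \<open>a + b x\<close> injective on \<open>D\<close>.\<close>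

lemma co_hopfian_substitution:
  assumes inj: "injective_module R M" and coh: "co_hopfian R M"
    and a: "a \<in> right_hom R M M" and b: "b \<in> right_hom R M M"
    and a': "a' \<in> right_hom R M M" and b': "b' \<in> right_hom R M M"
    and one: "\<And>z. z \<in> carrier M \<Longrightarrow> a (a' z) \<oplus>\<^bsub>M\<^esub> b (b' z) = z"
  obtains x where "x \<in> right_hom R M M"
    "\<And>m. \<lbrakk>m \<in> carrier M; a m \<oplus>\<^bsub>M\<^esub> b (x m) = \<zero>\<^bsub>M\<^esub>\<rbrakk> \<Longrightarrow> m = \<zero>\<^bsub>M\<^esub>"
proof -
  interpret P: right_module R "prod_module M M"
    by (rule right_module_prod_module[OF right_module_axioms right_module_axioms])
  note aD = right_homD[OF a] and bD = right_homD[OF b]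
    and a'D = right_homD[OF a'] and b'D = right_homD[OF b']
  define P where "P = {(m :: 'b, y :: 'b). (m = \<zero>\<^bsub>M\<^esub> \<longrightarrow> y = \<zero>\<^bsub>M\<^esub>) \<and>
    (a m \<oplus>\<^bsub>M\<^esub> b y = \<zero>\<^bsub>M\<^esub> \<longrightarrow> m = \<zero>\<^bsub>M\<^esub>)}"
  have "{\<zero>\<^bsub>prod_module M M\<^esub>} \<subseteq> P"
    by (simp add: P_def)
  then obtain G where G: "right_submodule R (prod_module M M) G" and GP: "G \<subseteq> P"
    and max: "\<And>B. \<lbrakk>right_submodule R (prod_module M M) B; G <+>\<^bsub>prod_module M M\<^esub> B \<subseteq> P\<rbrakk> \<Longrightarrow> B \<subseteq> G"
    using P.right_submodule_maximal[OF P.right_submodule_zero] by metis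
  note GD = right_submodule_prodD[OF G]
  have "y = \<zero>\<^bsub>M\<^esub>" if "(\<zero>\<^bsub>M\<^esub>, y) \<in> G" for y
    using that GP by (auto simp: P_def)
  then obtain x where x: "x \<in> right_hom R M M" and xG: "\<And>m y. (m, y) \<in> G \<Longrightarrow> x m = y"
    using injective_module_extend[OF inj right_module_axioms G] by metis
  note xD = right_homD[OF x]
  define u where "u m = a m \<oplus>\<^bsub>M\<^esub> b (x m)" for m
  have u: "u \<in> right_hom R M M"
    unfolding u_def by (intro right_homI) (simp_all add: aD bD xD M.a_ac rsmult_l_distr)
  note uD = right_homD[OF u]
  define D where "D = {d. (d, x d) \<in> G}"
  have GDx: "m \<in> D \<and> y = x m" if "(m, y) \<in> G" for m y
    using xG[OF that] that by (auto simp: D_def)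
  have D: "right_submodule R M D"
    unfolding right_submodule_def D_def
    using GD endo_zero[OF x] by (auto simp: xD)
  note DD = right_submoduleD[OF D]
  have uD0: "d = \<zero>\<^bsub>M\<^esub>" if "d \<in> D" "u d = \<zero>\<^bsub>M\<^esub>" for d
    using that GP by (auto simp: D_def P_def u_def)
  define U where "U = {m \<in> carrier M. u m = \<zero>\<^bsub>M\<^esub>}"
  have U: "right_submodule R M U"
    unfolding U_def by (rule right_submodule_kernel[OF u])
  note UD = right_submoduleD[OF U]

  \<comment> \<open>if \<open>X\<close> meets \<open>D + ker u\<close> trivially, \<open>u\<close> is injective on \<open>D + X\<close>, so the graph of \<open>x\<close> on \<open>X\<close>
      can be added to \<open>G\<close>\<close>
  have ess: "X \<subseteq> {\<zero>\<^bsub>M\<^esub>}" if X: "right_submodule R M X" "(D <+>\<^bsub>M\<^esub> U) \<inter> X \<subseteq> {\<zero>\<^bsub>M\<^esub>}" for X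
  proof -
    note XD = right_submoduleD[OF X(1)]
    let ?B = "{(e, x e) | e. e \<in> X}"
    have "right_submodule R (prod_module M M) ?B"
      using XD endo_zero[OF x] xD(1) by (intro right_submodule_prodI) (auto simp: xD)
    moreover have "G <+>\<^bsub>prod_module M M\<^esub> ?B \<subseteq> P"
    proof
      fix p assume "p \<in> G <+>\<^bsub>prod_module M M\<^esub> ?B"
      then obtain d e where d: "d \<in> D" and e: "e \<in> X" and p: "p = (d \<oplus>\<^bsub>M\<^esub> e, x d \<oplus>\<^bsub>M\<^esub> x e)"
        using GDx by (fastforce simp: mem_set_add_iff)
      have c: "d \<in> carrier M" "e \<in> carrier M"
        using d e DD(1) XD(1) by auto
      have p: "p = (d \<oplus>\<^bsub>M\<^esub> e, x (d \<oplus>\<^bsub>M\<^esub> e))"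
        using p c by (simp add: xD)
      have "d \<oplus>\<^bsub>M\<^esub> e = \<zero>\<^bsub>M\<^esub>" if u0: "u (d \<oplus>\<^bsub>M\<^esub> e) = \<zero>\<^bsub>M\<^esub>"
      proof -
        have "e = \<ominus>\<^bsub>M\<^esub> d \<oplus>\<^bsub>M\<^esub> (d \<oplus>\<^bsub>M\<^esub> e)"
          using c by (simp add: M.r_neg1)
        moreover have "d \<oplus>\<^bsub>M\<^esub> e \<in> U"
          using c u0 by (simp add: U_def)
        ultimately have "e \<in> D <+>\<^bsub>M\<^esub> U"
          using right_submodule_minus[OF D d] unfolding mem_set_add_iff by blast
        then have "e = \<zero>\<^bsub>M\<^esub>"
          using e X(2) by blast
        then show ?thesis
          using u0 c uD0[OF d] by simp
      qed
      then show "p \<in> P"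
        using endo_zero[OF x] by (simp add: p P_def u_def)
    qed
    ultimately have "?B \<subseteq> G"
      by (rule max)
    then have "X \<subseteq> D"
      using GDx by blast
    then show ?thesis
      using X(2) subset_right_submodule_set_add(1)[OF D U] by blast
  qed

  define T where "T = u ` D"
  have T: "right_submodule R M T"
    unfolding T_def by (rule right_submodule_image[OF u D])
  obtain C where C: "right_submodule R M C" and TC: "T \<inter> C \<subseteq> {\<zero>\<^bsub>M\<^esub>}"
    and Cmax: "\<And>X. \<lbrakk>right_submodule R M X; C \<subseteq> X; T \<inter> X \<subseteq> {\<zero>\<^bsub>M\<^esub>}\<rbrakk> \<Longrightarrow> X = C"
    using maximal_complement[OF T] by metis
  note CD = right_submoduleD[OF C]
  \<comment> \<open>the graph of \<open>u\<^sup>-\<^sup>1\<close> on \<open>T\<close> and zero on \<open>C\<close>\<close>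
  define J where "J = {(u d \<oplus>\<^bsub>M\<^esub> c, d) | d c. d \<in> D \<and> c \<in> C}"
  have "right_submodule R (prod_module M M) J"
  proof (rule right_submodule_prodI)
    show "(\<zero>\<^bsub>M\<^esub>, \<zero>\<^bsub>M\<^esub>) \<in> J"
      using DD(2) CD(2) endo_zero[OF u] unfolding J_def by force
    fix z d assume "(z, d) \<in> J"
    then obtain c where dc: "d \<in> D" "c \<in> C" and z: "z = u d \<oplus>\<^bsub>M\<^esub> c"
      by (auto simp: J_def)
    note cl = DD(1)[OF dc(1)] CD(1)[OF dc(2)] uD(1)[OF DD(1)[OF dc(1)]]
    show "z \<in> carrier M \<and> d \<in> carrier M"
      using cl z by simp
    show "(z \<odot>\<^sub>r\<^bsub>M\<^esub> r, d \<odot>\<^sub>r\<^bsub>M\<^esub> r) \<in> J" if "r \<in> carrier R" for r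
      unfolding J_def mem_Collect_eq
      using cl z that DD(4)[OF dc(1)] CD(4)[OF dc(2)]
      by (intro exI[of _ "d \<odot>\<^sub>r\<^bsub>M\<^esub> r"] exI[of _ "c \<odot>\<^sub>r\<^bsub>M\<^esub> r"]) (simp add: rsmult_l_distr uD(3))
    fix z' d' assume "(z', d') \<in> J"
    then obtain c' where dc': "d' \<in> D" "c' \<in> C" and z': "z' = u d' \<oplus>\<^bsub>M\<^esub> c'"
      by (auto simp: J_def)
    note cl' = DD(1)[OF dc'(1)] CD(1)[OF dc'(2)] uD(1)[OF DD(1)[OF dc'(1)]]
    show "(z \<oplus>\<^bsub>M\<^esub> z', d \<oplus>\<^bsub>M\<^esub> d') \<in> J"
      unfolding J_def mem_Collect_eq
      using cl z cl' z' DD(3)[OF dc(1) dc'(1)] CD(3)[OF dc(2) dc'(2)]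
      by (intro exI[of _ "d \<oplus>\<^bsub>M\<^esub> d'"] exI[of _ "c \<oplus>\<^bsub>M\<^esub> c'"]) (simp add: M.a_ac uD(2))
  qed
  moreover have "d = \<zero>\<^bsub>M\<^esub>" if zd: "(\<zero>\<^bsub>M\<^esub>, d) \<in> J" for d
  proof -
    obtain c where dc: "d \<in> D" "c \<in> C" "\<zero>\<^bsub>M\<^esub> = u d \<oplus>\<^bsub>M\<^esub> c"
      using zd by (auto simp: J_def)
    have cl: "c \<in> carrier M" "u d \<in> carrier M"
      using dc CD(1) DD(1) uD(1) by auto
    have "u d = \<ominus>\<^bsub>M\<^esub> c"
      using dc(3) cl M.minus_equality[of "u d" c] by simp
    then have "u d \<in> C"
      using right_submodule_minus[OF C dc(2)] by simp
    moreover have "u d \<in> T"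
      unfolding T_def using dc(1) by (rule imageI)
    ultimately show ?thesis
      using TC uD0 dc(1) by blast
  qed
  ultimately obtain t where t: "t \<in> right_hom R M M" and tJ: "\<And>z d. (z, d) \<in> J \<Longrightarrow> t z = d"
    using injective_module_extend[OF inj right_module_axioms] by metis
  have tu: "t (u d) = d" if "d \<in> D" for d
    using that CD(2) uD(1)[OF DD(1)[OF that]] by (intro tJ) (force simp: J_def)
  have tC: "t c = \<zero>\<^bsub>M\<^esub>" if "c \<in> C" for c
    using that DD(2) CD(1)[OF that] endo_zero[OF u] by (intro tJ) (force simp: J_def)
  \<comment> \<open>\<open>ker t\<close> and the preimage of \<open>ker u\<close> under \<open>t\<close> both contain \<open>C\<close> and meet \<open>T\<close> trivially, so
      both are equal to \<open>C\<close>\<close>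
  have kert: "{z \<in> carrier M. t z = \<zero>\<^bsub>M\<^esub>} = C"
    using CD(1) tC tu endo_zero[OF u]
    by (intro Cmax right_submodule_kernel t) (auto simp: T_def)
  have Ut: "t z = \<zero>\<^bsub>M\<^esub>" if "z \<in> carrier M" "t z \<in> U" for z
  proof -
    have "{z \<in> carrier M. t z \<in> U} = C"
    proof (intro Cmax right_submodule_vimage t U)
      show "C \<subseteq> {z \<in> carrier M. t z \<in> U}"
        using CD(1) tC UD(2) by auto
      show "T \<inter> {z \<in> carrier M. t z \<in> U} \<subseteq> {\<zero>\<^bsub>M\<^esub>}"
        using tu by (auto simp: T_def U_def)
    qed
    then show ?thesis
      using that tC by blast
  qed

  \<comment> \<open>a partial isomorphism from \<open>ker u\<close> into \<open>C\<close> is zero where \<open>a'\<close> maps into \<open>D + ker u\<close>: there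
      it would yield an enlargement of \<open>G\<close>\<close>
  have vanish: "c = \<zero>\<^bsub>M\<^esub>"
    if \<phi>: "partial_isomorphism R M \<phi>" "\<phi> \<subseteq> U \<times> C"
      and ec: "(e, c) \<in> \<phi>" "a' c \<in> D <+>\<^bsub>M\<^esub> U" for \<phi> e c
  proof -
    define \<psi> where "\<psi> = \<phi> \<inter> UNIV \<times> {c \<in> carrier M. a' c \<in> D <+>\<^bsub>M\<^esub> U}"
    have "partial_isomorphism R M \<psi>"
      unfolding \<psi>_def
      by (intro partial_isomorphism_restrict \<phi> right_submodule_vimage a' right_submodule_set_add D U)
    then have \<psi>: "right_submodule R (prod_module M M) \<psi>"
      and iso: "\<And>e c. (e, c) \<in> \<psi> \<Longrightarrow> e = \<zero>\<^bsub>M\<^esub> \<longleftrightarrow> c = \<zero>\<^bsub>M\<^esub>"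
      by (auto simp: partial_isomorphism_def)
    note \<psi>D = right_submodule_prodD[OF \<psi>]
    \<comment> \<open>the correction to \<open>x\<close>: since \<open>u a' + b (b' - x a') = 1\<close>, it satisfies \<open>b y = 1 - u a'\<close>\<close>
    define y where "y c = b' c \<ominus>\<^bsub>M\<^esub> x (a' c)" for c
    have y: "y \<in> right_hom R M M"
      unfolding y_def
    proof (rule right_homI)
      fix c c' assume c: "c \<in> carrier M" "c' \<in> carrier M"
      then show "b' (c \<oplus>\<^bsub>M\<^esub> c') \<ominus>\<^bsub>M\<^esub> x (a' (c \<oplus>\<^bsub>M\<^esub> c')) =
          b' c \<ominus>\<^bsub>M\<^esub> x (a' c) \<oplus>\<^bsub>M\<^esub> (b' c' \<ominus>\<^bsub>M\<^esub> x (a' c'))"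
        by (simp add: a_minus_def a'D b'D xD M.minus_add M.a_ac)
    next
      fix c r assume c: "c \<in> carrier M" "r \<in> carrier R"
      have "x (a' (c \<odot>\<^sub>r\<^bsub>M\<^esub> r)) = x (a' c) \<odot>\<^sub>r\<^bsub>M\<^esub> r"
        using c by (simp add: a'D xD)
      moreover have "\<ominus>\<^bsub>M\<^esub> (x (a' c) \<odot>\<^sub>r\<^bsub>M\<^esub> r) = (\<ominus>\<^bsub>M\<^esub> x (a' c)) \<odot>\<^sub>r\<^bsub>M\<^esub> r"
        using c rsmult_l_distr[of "\<ominus>\<^bsub>M\<^esub> x (a' c)" "x (a' c)" r]
        by (intro M.minus_equality) (auto simp: a'D xD M.l_neg)
      ultimately show "b' (c \<odot>\<^sub>r\<^bsub>M\<^esub> r) \<ominus>\<^bsub>M\<^esub> x (a' (c \<odot>\<^sub>r\<^bsub>M\<^esub> r)) = (b' c \<ominus>\<^bsub>M\<^esub> x (a' c)) \<odot>\<^sub>r\<^bsub>M\<^esub> r"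
        using c by (simp add: a_minus_def a'D b'D xD rsmult_l_distr)
    qed (simp add: a'D b'D xD)
    note yD = right_homD[OF y]
    have by_eq: "b (y c) \<oplus>\<^bsub>M\<^esub> u (a' c) = c" if "c \<in> carrier M" for c
    proof -
      have "b (y c) \<oplus>\<^bsub>M\<^esub> b (x (a' c)) = b (b' c)"
        using that by (simp flip: bD(2) add: y_def a_minus_def a'D b'D xD M.a_assoc M.l_neg)
      then have "c = a (a' c) \<oplus>\<^bsub>M\<^esub> (b (y c) \<oplus>\<^bsub>M\<^esub> b (x (a' c)))"
        using one[OF that] by simp
      then show ?thesis
        using that by (simp add: u_def aD bD a'D xD yD M.a_ac)
    qed
    define B where "B = {(e, x e \<oplus>\<^bsub>M\<^esub> y c) | e c. (e, c) \<in> \<psi>}"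
    have "right_submodule R (prod_module M M) B"
    proof (rule right_submodule_prodI)
      show "(\<zero>\<^bsub>M\<^esub>, \<zero>\<^bsub>M\<^esub>) \<in> B"
        using \<psi>D(3) endo_zero[OF x] endo_zero[OF y] unfolding B_def by force
      fix e z assume "(e, z) \<in> B"
      then obtain c where ec: "(e, c) \<in> \<psi>" and z: "z = x e \<oplus>\<^bsub>M\<^esub> y c"
        by (auto simp: B_def)
      note cl = \<psi>D(1)[OF ec] \<psi>D(2)[OF ec]
      show "e \<in> carrier M \<and> z \<in> carrier M"
        using cl z by (simp add: xD yD)
      show "(e \<odot>\<^sub>r\<^bsub>M\<^esub> r, z \<odot>\<^sub>r\<^bsub>M\<^esub> r) \<in> B" if "r \<in> carrier R" for r
        unfolding B_def mem_Collect_eq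
        using cl z that \<psi>D(5)[OF ec that]
        by (intro exI[of _ "e \<odot>\<^sub>r\<^bsub>M\<^esub> r"] exI[of _ "c \<odot>\<^sub>r\<^bsub>M\<^esub> r"]) (simp add: rsmult_l_distr xD yD)
      fix e' z' assume "(e', z') \<in> B"
      then obtain c' where ec': "(e', c') \<in> \<psi>" and z': "z' = x e' \<oplus>\<^bsub>M\<^esub> y c'"
        by (auto simp: B_def)
      note cl' = \<psi>D(1)[OF ec'] \<psi>D(2)[OF ec']
      show "(e \<oplus>\<^bsub>M\<^esub> e', z \<oplus>\<^bsub>M\<^esub> z') \<in> B"
        unfolding B_def mem_Collect_eq
        using cl z cl' z' \<psi>D(4)[OF ec ec']
        by (intro exI[of _ "e \<oplus>\<^bsub>M\<^esub> e'"] exI[of _ "c \<oplus>\<^bsub>M\<^esub> c'"]) (simp add: M.a_ac xD yD)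
    qed
    moreover have "G <+>\<^bsub>prod_module M M\<^esub> B \<subseteq> P"
    proof
      fix p assume "p \<in> G <+>\<^bsub>prod_module M M\<^esub> B"
      then obtain d e c where d: "d \<in> D" and ec: "(e, c) \<in> \<psi>"
        and p: "p = (d \<oplus>\<^bsub>M\<^esub> e, x d \<oplus>\<^bsub>M\<^esub> (x e \<oplus>\<^bsub>M\<^esub> y c))"
        using GDx by (fastforce simp: mem_set_add_iff B_def)
      have cl: "d \<in> carrier M" "e \<in> carrier M" "c \<in> carrier M"
        using DD(1)[OF d] \<psi>D(1,2)[OF ec] by auto
      have eU: "e \<in> U" and cC: "c \<in> C" and ac: "a' c \<in> D <+>\<^bsub>M\<^esub> U"
        using ec \<phi>(2) by (auto simp: \<psi>_def)
      have ue: "u e = \<zero>\<^bsub>M\<^esub>"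
        using eU by (simp add: U_def)
      have 1: "x d \<oplus>\<^bsub>M\<^esub> (x e \<oplus>\<^bsub>M\<^esub> y c) = \<zero>\<^bsub>M\<^esub>" if de: "d \<oplus>\<^bsub>M\<^esub> e = \<zero>\<^bsub>M\<^esub>"
      proof -
        have "u d = \<zero>\<^bsub>M\<^esub>"
          using arg_cong[OF de, of u] cl ue by (simp add: uD endo_zero[OF u])
        then have "d = \<zero>\<^bsub>M\<^esub>"
          by (rule uD0[OF d])
        moreover then have "e = \<zero>\<^bsub>M\<^esub>"
          using de cl by simp
        moreover then have "c = \<zero>\<^bsub>M\<^esub>"
          using iso[OF ec] by simp
        ultimately show ?thesis
          by (simp add: endo_zero[OF x] endo_zero[OF y])
      qed
      have 2: "d \<oplus>\<^bsub>M\<^esub> e = \<zero>\<^bsub>M\<^esub>"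
        if ab: "a (d \<oplus>\<^bsub>M\<^esub> e) \<oplus>\<^bsub>M\<^esub> b (x d \<oplus>\<^bsub>M\<^esub> (x e \<oplus>\<^bsub>M\<^esub> y c)) = \<zero>\<^bsub>M\<^esub>"
      proof -
        have "a (d \<oplus>\<^bsub>M\<^esub> e) \<oplus>\<^bsub>M\<^esub> b (x d \<oplus>\<^bsub>M\<^esub> (x e \<oplus>\<^bsub>M\<^esub> y c)) = b (y c) \<oplus>\<^bsub>M\<^esub> (u d \<oplus>\<^bsub>M\<^esub> u e)"
          using cl by (simp add: u_def aD bD xD yD M.a_ac)
        then have byc: "b (y c) = \<ominus>\<^bsub>M\<^esub> u d"
          using ab ue cl M.minus_equality[of "b (y c)" "u d"] by (simp add: uD bD yD)
        obtain d' k where d': "d' \<in> D" and k: "k \<in> U" and acd: "a' c = d' \<oplus>\<^bsub>M\<^esub> k"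
          using ac unfolding mem_set_add_iff by blast
        have cl': "d' \<in> carrier M" "k \<in> carrier M" "u k = \<zero>\<^bsub>M\<^esub>"
          using DD(1)[OF d'] k by (auto simp: U_def)
        have "c = \<ominus>\<^bsub>M\<^esub> u d \<oplus>\<^bsub>M\<^esub> u d'"
          using by_eq[OF cl(3)] byc acd cl' by (simp add: uD)
        also have "\<dots> = u (\<ominus>\<^bsub>M\<^esub> d \<oplus>\<^bsub>M\<^esub> d')"
          using cl cl' by (simp add: uD endo_minus[OF u])
        finally have "c \<in> T"
          using DD(3)[OF right_submodule_minus[OF D d] d'] unfolding T_def by blast
        then have c0: "c = \<zero>\<^bsub>M\<^esub>"
          using cC TC by blast
        then have "e = \<zero>\<^bsub>M\<^esub>"
          using iso[OF ec] by simp
        moreover have "u d = \<zero>\<^bsub>M\<^esub>"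
          using M.minus_minus[of "u d"] byc[symmetric] c0 cl uD(1)
          by (simp add: endo_zero[OF y] endo_zero[OF b])
        ultimately show ?thesis
          using uD0[OF d] by simp
      qed
      show "p \<in> P"
        unfolding p P_def mem_Collect_eq prod.case using 1 2 by blast
    qed
    ultimately have "B \<subseteq> G"
      by (rule max)
    have "(e, c) \<in> \<psi>"
      using ec \<phi>(2) CD(1) by (auto simp: \<psi>_def)
    then have "e \<in> D"
      using \<open>B \<subseteq> G\<close> GDx unfolding B_def by blast
    moreover have "u e = \<zero>\<^bsub>M\<^esub>"
      using ec(1) \<phi>(2) by (auto simp: U_def)
    ultimately have "e = \<zero>\<^bsub>M\<^esub>"
      by (rule uD0)
    then show ?thesis
      using iso[OF \<open>(e, c) \<in> \<psi>\<close>] by simp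
  qed
  \<comment> \<open>as \<open>D + ker u\<close> is essential, \<open>a'\<close> kills the whole range of \<open>\<phi>\<close>\<close>
  have "orthogonal R M U C"
    unfolding orthogonal_def
  proof (intro allI impI)
    fix \<phi> assume \<phi>: "partial_isomorphism R M \<phi>" "\<phi> \<subseteq> U \<times> C"
    have sub\<phi>: "right_submodule R (prod_module M M) \<phi>"
      using \<phi>(1) by (simp add: partial_isomorphism_def)
    note \<phi>D = right_submodule_prodD[OF sub\<phi>]
    have "right_submodule R M {c. \<exists>e. (e, c) \<in> \<phi>}"
      unfolding right_submodule_def using \<phi>D by blast
    then have "right_submodule R M (a' ` {c. \<exists>e. (e, c) \<in> \<phi>})"
      by (rule right_submodule_image[OF a'])
    moreover have "(D <+>\<^bsub>M\<^esub> U) \<inter> a' ` {c. \<exists>e. (e, c) \<in> \<phi>} \<subseteq> {\<zero>\<^bsub>M\<^esub>}"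
      using vanish[OF \<phi>] endo_zero[OF a'] by auto
    ultimately have "a' ` {c. \<exists>e. (e, c) \<in> \<phi>} \<subseteq> {\<zero>\<^bsub>M\<^esub>}"
      by (rule ess)
    moreover have "\<zero>\<^bsub>M\<^esub> \<in> D <+>\<^bsub>M\<^esub> U"
      by (rule right_submoduleD(2)[OF right_submodule_set_add[OF D U]])
    ultimately have "a' c \<in> D <+>\<^bsub>M\<^esub> U" if "(e, c) \<in> \<phi>" for e c
      using that by fastforce
    then have "c = \<zero>\<^bsub>M\<^esub>" if "(e, c) \<in> \<phi>" for e c
      using vanish[OF \<phi>] that by blast
    then show "\<phi> \<subseteq> {(\<zero>\<^bsub>M\<^esub>, \<zero>\<^bsub>M\<^esub>)}"
      using \<phi>(1) unfolding partial_isomorphism_def by fast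
  qed
  then have "U \<subseteq> {\<zero>\<^bsub>M\<^esub>}"
    using co_hopfian_cokernel_trivial[OF inj coh t U Ut] kert by simp
  then show ?thesis
    using that[OF x] unfolding U_def u_def by blast
qed

section \<open>Stable range of the endomorphism ring\<close>

lemma End_ring_simps:
  "f \<in> carrier (End_ring R M) \<Longrightarrow> f \<in> right_hom R M M"
  "f \<in> right_hom R M M \<Longrightarrow> restrict f (carrier M) \<in> carrier (End_ring R M)"
  "x \<in> carrier M \<Longrightarrow> (f \<otimes>\<^bsub>End_ring R M\<^esub> g) x = f (g x)"
  "x \<in> carrier M \<Longrightarrow> (f \<oplus>\<^bsub>End_ring R M\<^esub> g) x = f x \<oplus>\<^bsub>M\<^esub> g x"
  "x \<in> carrier M \<Longrightarrow> \<one>\<^bsub>End_ring R M\<^esub> x = x"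
  by (auto simp: End_ring_def right_hom_def compose_def)

lemma End_ring_eqI:
  assumes "f \<in> carrier (End_ring R M)" "g \<in> carrier (End_ring R M)"
    and "\<And>x. x \<in> carrier M \<Longrightarrow> f x = g x"
  shows "f = g"
  using assms by (intro extensionalityI[of f "carrier M" g]) (auto simp: End_ring_def)

text \<open>The inverse on the image of \<open>u\<close> extends to \<open>M\<close>.\<close>

lemma injective_endo_left_invertible:
  assumes inj: "injective_module R M" and u: "u \<in> carrier (End_ring R M)"
    and u0: "\<And>x. \<lbrakk>x \<in> carrier M; u x = \<zero>\<^bsub>M\<^esub>\<rbrakk> \<Longrightarrow> x = \<zero>\<^bsub>M\<^esub>"
  obtains t where "t \<in> carrier (End_ring R M)" "t \<otimes>\<^bsub>End_ring R M\<^esub> u = \<one>\<^bsub>End_ring R M\<^esub>"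
proof -
  interpret E: ring "End_ring R M"
    by (rule ring_End_ring)
  note u' = End_ring_simps(1)[OF u]
  note uD = right_homD[OF u']
  define G where "G = (\<lambda>x. (u x, x)) ` carrier M"
  have "right_submodule R (prod_module M M) G"
    using endo_zero[OF u'] unfolding G_def
    by (intro right_submodule_prodI) (auto simp: uD image_iff)
  moreover have "y = \<zero>\<^bsub>M\<^esub>" if "(\<zero>\<^bsub>M\<^esub>, y) \<in> G" for y
    using that u0 by (auto simp: G_def)
  ultimately obtain t where t: "t \<in> right_hom R M M" and tG: "\<And>x y. (x, y) \<in> G \<Longrightarrow> t x = y"
    using injective_module_extend[OF inj right_module_axioms] by metis
  show ?thesis
  proof
    show T: "restrict t (carrier M) \<in> carrier (End_ring R M)"
      by (rule End_ring_simps(2)[OF t])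
    show "restrict t (carrier M) \<otimes>\<^bsub>End_ring R M\<^esub> u = \<one>\<^bsub>End_ring R M\<^esub>"
      using tG by (intro End_ring_eqI E.m_closed T u E.one_closed) (auto simp: End_ring_simps uD G_def)
  qed
qed

end

theorem theorem24:
  fixes R :: "('a, 'r) ring_scheme"
    and M :: "('a, 'b, 'm) right_module_scheme"
  assumes "ring R" and "\<one>\<^bsub>R\<^esub> \<noteq> \<zero>\<^bsub>R\<^esub>"
    and "right_module R M" and "injective_module R M"
    and "\<And>s. \<lbrakk>s \<in> carrier (End_ring R M); right_singular (End_ring R M) s\<rbrakk>
      \<Longrightarrow> product_of_idempotents (End_ring R M) s"
  shows "stable_range_one (End_ring R M)"
proof -
  interpret right_module R M by fact
  interpret E: ring "End_ring R M"
    by (rule ring_End_ring)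
  let ?E = "End_ring R M"
  have unit: "u \<in> Units ?E"
    if u: "u \<in> carrier ?E" "\<And>x. \<lbrakk>x \<in> carrier M; u x = \<zero>\<^bsub>M\<^esub>\<rbrakk> \<Longrightarrow> x = \<zero>\<^bsub>M\<^esub>" for u
  proof -
    obtain t where t: "t \<in> carrier ?E" "t \<otimes>\<^bsub>?E\<^esub> u = \<one>\<^bsub>?E\<^esub>"
      using injective_endo_left_invertible[OF assms(4) u] by metis
    moreover have "u \<otimes>\<^bsub>?E\<^esub> t = \<one>\<^bsub>?E\<^esub>"
      using E.directly_finite_if_right_singular_products[OF assms(5)] t u(1) by blast
    ultimately show ?thesis
      using u(1) by (auto simp: Units_def)
  qed
  have coh: "co_hopfian R M"
    unfolding co_hopfian_def
  proof (intro ballI impI subsetI)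
    fix v y assume v: "v \<in> right_hom R M M" and y: "y \<in> carrier M"
      and v0: "\<forall>x \<in> carrier M. v x = \<zero>\<^bsub>M\<^esub> \<longrightarrow> x = \<zero>\<^bsub>M\<^esub>"
    let ?v = "restrict v (carrier M)"
    have "?v \<in> Units ?E"
      using v0 by (intro unit End_ring_simps v) auto
    then obtain w where w: "w \<in> carrier ?E" "?v \<otimes>\<^bsub>?E\<^esub> w = \<one>\<^bsub>?E\<^esub>"
      by (auto simp: Units_def)
    then have "w y \<in> carrier M"
      using y right_homD(1)[OF End_ring_simps(1)] by blast
    moreover have "?v (w y) = y"
      using fun_cong[OF w(2), of y] y by (simp add: End_ring_simps)
    ultimately show "y \<in> v ` carrier M"
      by (metis imageI restrict_apply')
  qed
  show ?thesis
    unfolding stable_range_one_def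
  proof (intro ballI impI)
    fix a b assume a: "a \<in> carrier ?E" and b: "b \<in> carrier ?E"
      and "(a <#\<^bsub>?E\<^esub> carrier ?E) <+>\<^bsub>?E\<^esub> (b <#\<^bsub>?E\<^esub> carrier ?E) = carrier ?E"
    then have "\<one>\<^bsub>?E\<^esub> \<in> (a <#\<^bsub>?E\<^esub> carrier ?E) <+>\<^bsub>?E\<^esub> (b <#\<^bsub>?E\<^esub> carrier ?E)"
      by simp
    then obtain a' b' where a': "a' \<in> carrier ?E" and b': "b' \<in> carrier ?E"
      and one: "a \<otimes>\<^bsub>?E\<^esub> a' \<oplus>\<^bsub>?E\<^esub> b \<otimes>\<^bsub>?E\<^esub> b' = \<one>\<^bsub>?E\<^esub>"
      by (auto simp: mem_set_add_iff l_coset_def)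
    have one': "a (a' z) \<oplus>\<^bsub>M\<^esub> b (b' z) = z" if "z \<in> carrier M" for z
      using fun_cong[OF one, of z] that by (simp add: End_ring_simps)
    obtain x where x: "x \<in> right_hom R M M"
      and x0: "\<And>m. \<lbrakk>m \<in> carrier M; a m \<oplus>\<^bsub>M\<^esub> b (x m) = \<zero>\<^bsub>M\<^esub>\<rbrakk> \<Longrightarrow> m = \<zero>\<^bsub>M\<^esub>"
      using co_hopfian_substitution[OF assms(4) coh End_ring_simps(1)[OF a] End_ring_simps(1)[OF b]
          End_ring_simps(1)[OF a'] End_ring_simps(1)[OF b'] one'] by metis
    let ?x = "restrict x (carrier M)"
    have X: "?x \<in> carrier ?E"
      by (rule End_ring_simps(2)[OF x])
    have "a \<oplus>\<^bsub>?E\<^esub> b \<otimes>\<^bsub>?E\<^esub> ?x \<in> Units ?E"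
      using x0 by (intro unit E.add.m_closed E.m_closed a b X) (simp add: End_ring_simps)
    with X show "\<exists>x \<in> carrier ?E. a \<oplus>\<^bsub>?E\<^esub> b \<otimes>\<^bsub>?E\<^esub> x \<in> Units ?E"
      by blast
  qed
qed

end
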